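(* There exist absolute constants $C, C', C''>0$ such that the following holds. Let $q$ be a positive integer, and let $A,B\subset \mathbb{Z}_q$ be nonempty sets with $|A|=\alpha q$, $|B|=\beta q$ and $\alpha\ge\beta$. Then there is a divisor $d\mid q$ with $$d\le C'\exp(C\beta^{-4})$$ such that $$d\cdot \mathbb{Z}_q\subseteq (A-A)(B-B).$$ In addition, $d$ satisfies $$d\le C'\,\beta^{-C''\omega(q)}.$$
   Context: $\mathbb{Z}_q=\mathbb{Z}/q\mathbb{Z}$. For $X,Y\subseteq\mathbb{Z}_q$: $X-Y=\{x-y: x\in X, y\in Y\}$, $XY=\{xy: x\in X,y\in Y\}$ (so $(A-A)(B-B)$ is the set of products of one element of $A-A$ and one element of $B-B$), and $d\cdot X=\{dx: x\in X\}$. $\omega(q)$ is the number of prime divisors of $q$. *)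

theory Defs
  imports Complex_Main "HOL-Number_Theory.Number_Theory"
begin

text \<open>
  \<open>\<int>/q\<int>\<close> is the library ring \<open>residue_ring (int q)\<close>, with carrier \<open>{0..q - 1}\<close> and
  operations reduced modulo \<open>q\<close>. The library locale \<open>residues\<close> covers only \<open>q > 1\<close>, and for
  \<open>q = 1\<close> the record field \<open>one\<close> lies outside the carrier \<open>{0}\<close>; the definitions below do
  not use \<open>one\<close>, and the lemmas show that they have the intended meaning for every \<open>q > 0\<close>.
\<close>

abbreviation Zmod :: "nat \<Rightarrow> int ring" where
  "Zmod q \<equiv> residue_ring (int q)"

definition diff_set :: "('a, 'm) ring_scheme \<Rightarrow> 'a set \<Rightarrow> 'a set \<Rightarrow> 'a set" where
  "diff_set R X Y = {x \<ominus>\<^bsub>R\<^esub> y | x y. x \<in> X \<and> y \<in> Y}"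

definition dilate :: "('a, 'm) ring_scheme \<Rightarrow> nat \<Rightarrow> 'a set \<Rightarrow> 'a set" where
  "dilate R d X = {[d] \<cdot>\<^bsub>R\<^esub> x | x. x \<in> X}"

definition omega :: "nat \<Rightarrow> nat" where
  "omega q = card {p. prime p \<and> p dvd q}"

lemma Zmod_carrier: "carrier (Zmod q) = {0..<int q}"
  by (auto simp: residue_ring_def)

lemma Zmod_mult: "x \<otimes>\<^bsub>Zmod q\<^esub> y = (x * y) mod int q"
  by (simp add: residue_ring_def)

lemma Zmod_uminus:
  assumes "q > 0" "y \<in> carrier (Zmod q)"
  shows "\<ominus>\<^bsub>Zmod q\<^esub> y = (- y) mod int q"
proof -
  have y: "0 \<le> y" "y < int q"
    using assms(2) by (auto simp: Zmod_carrier)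
  have uniq: "z = (- y) mod int q" if z: "0 \<le> z" "z < int q" "(y + z) mod int q = 0" for z
  proof -
    have "int q dvd z - (- y)"
      using z(3) by (simp add: mod_eq_0_iff_dvd add.commute)
    then have "z mod int q = (- y) mod int q"
      by (simp only: mod_eq_dvd_iff)
    with z show ?thesis by simp
  qed
  show ?thesis
    unfolding a_inv_def m_inv_def
  proof (rule the_equality)
    show "(- y) mod int q \<in> carrier (add_monoid (Zmod q)) \<and>
      y \<otimes>\<^bsub>add_monoid (Zmod q)\<^esub> ((- y) mod int q) = \<one>\<^bsub>add_monoid (Zmod q)\<^esub> \<and>
      ((- y) mod int q) \<otimes>\<^bsub>add_monoid (Zmod q)\<^esub> y = \<one>\<^bsub>add_monoid (Zmod q)\<^esub>"
      using assms(1) by (auto simp: residue_ring_def mod_simps)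
  next
    fix z
    assume "z \<in> carrier (add_monoid (Zmod q)) \<and>
      y \<otimes>\<^bsub>add_monoid (Zmod q)\<^esub> z = \<one>\<^bsub>add_monoid (Zmod q)\<^esub> \<and>
      z \<otimes>\<^bsub>add_monoid (Zmod q)\<^esub> y = \<one>\<^bsub>add_monoid (Zmod q)\<^esub>"
    then show "z = (- y) mod int q"
      by (intro uniq) (auto simp: residue_ring_def)
  qed
qed

lemma Zmod_minus:
  assumes "q > 0" "y \<in> carrier (Zmod q)"
  shows "x \<ominus>\<^bsub>Zmod q\<^esub> y = (x - y) mod int q"
  unfolding a_minus_def Zmod_uminus[OF assms]
  by (simp add: residue_ring_def mod_simps)

lemma Zmod_add_pow:
  shows "[d] \<cdot>\<^bsub>Zmod q\<^esub> x = (int d * x) mod int q"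
proof (induction d)
  case 0
  then show ?case by (simp add: add_pow_def nat_pow_def residue_ring_def)
next
  case (Suc d)
  have "[Suc d] \<cdot>\<^bsub>Zmod q\<^esub> x = ([d] \<cdot>\<^bsub>Zmod q\<^esub> x + x) mod int q"
    by (simp add: add_pow_def nat_pow_def residue_ring_def)
  with Suc show ?case
    by (simp add: mod_simps algebra_simps)
qed

end

theory Submission
  imports Defs
begin

text \<open>
  Put \<open>\<omega> = \<omega>(q)\<close> and \<open>D = A - A\<close>, \<open>E = B - B\<close>. There are two regimes.

  If \<open>\<omega> \<ge> 1/\<beta>\<close> or \<open>\<beta> > 1/2\<close>, let \<open>m = \<lfloor>1/\<beta>\<rfloor>\<close>. Translating \<open>A\<^sup>m\<close> by multiples of the vector \<open>(m!/k)\<close>, \<open>1 \<le> k \<le> m\<close>, two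
  translates meet, which yields \<open>f \<le> \<beta>\<^sup>-\<^sup>m\<close> with \<open>f m!/k \<in> D\<close> for all \<open>k \<le> m\<close> at once. For every \<open>x\<close>
  some \<open>k \<le> m\<close> has \<open>k x \<in> E\<close>, so \<open>f m! x \<in> D E\<close>, and \<open>f m! \<le> \<beta>\<^sup>-\<^sup>2\<^sup>m\<close>.

  Otherwise let \<open>R\<^sub>r\<close> be the product over \<open>p | q\<close> of the largest power of \<open>p\<close> below \<open>Y\<^sup>r\<close>, for a
  constant \<open>Y\<close>. To represent \<open>R\<^sub>T x\<close>, one looks for solutions \<open>(R\<^sub>i t, x (R\<^sub>T/R\<^sub>i) t\<^sup>-\<^sup>1)\<close> in \<open>D \<times> E\<close>
  with \<open>t\<close> a unit. Expanding in characters, the pair of frequencies \<open>(\<xi>, \<eta>)\<close> is weighted by a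
  Kloosterman sum, whose normalised size is at most \<open>8\<^sup>-\<^sup>r\<close> unless \<open>R\<^sub>r\<close> annihilates both of its
  arguments. The frequencies annihilated by \<open>R\<^sub>r\<close> carry the energy of \<open>A\<close> and \<open>B\<close> on cosets
  of \<open>R\<^sub>iR\<^sub>r\<close> and \<open>x(R\<^sub>T/R\<^sub>i)R\<^sub>r\<close>. These energies range over an interval of ratio \<open>1/\<beta>\<close>, so as \<open>i\<close>
  runs through \<open>T \<approx> log(1/\<beta>)\<close> values only few \<open>i\<close> see an energy growth faster than \<open>(11/10)\<^sup>r\<close>. At any
  other \<open>i\<close> the trivial frequencies dominate and a solution exists. Finally \<open>R\<^sub>T \<le> Y\<^bsup>T\<omega>\<^esup>\<close>.
\<close>

section \<open>Additive characters modulo q\<close>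

definition add_char :: "nat \<Rightarrow> int \<Rightarrow> complex" where
  "add_char q z = cis (2 * pi * of_int z / of_nat q)"

lemma add_char_add: "add_char q (x + y) = add_char q x * add_char q y"
  by (simp add: add_char_def cis_mult ring_distribs add_divide_distrib)

lemma add_char_minus: "add_char q (- x) = cnj (add_char q x)"
  by (simp add: add_char_def cis_cnj)

lemma add_char_diff: "add_char q (x - y) = add_char q x * cnj (add_char q y)"
  using add_char_add[of q x "- y"] by (simp add: add_char_minus)

lemma norm_add_char [simp]: "norm (add_char q z) = 1"
  by (simp add: add_char_def)

lemma add_char_0 [simp]: "add_char q 0 = 1"
  by (simp add: add_char_def)

lemma add_char_eq_1_iff:
  assumes "q > 0"
  shows "add_char q z = 1 \<longleftrightarrow> int q dvd z"
proof
  assume "add_char q z = 1"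
  then have "cos (2 * pi * of_int z / of_nat q) = 1"
    by (simp add: add_char_def complex_eq_iff)
  then obtain n :: int where "2 * pi * of_int z / of_nat q = of_int n * 2 * pi"
    by (auto simp: cos_one_2pi_int)
  then have "real_of_int z = of_int (n * int q)"
    using assms by (simp add: field_simps)
  then show "int q dvd z"
    by (simp only: of_int_eq_iff) simp
next
  assume "int q dvd z"
  then obtain n where z: "z = int q * n" ..
  have "2 * pi * real_of_int z / real q = 2 * pi * of_int n"
    using assms by (simp add: z)
  then show "add_char q z = 1"
    unfolding add_char_def
    by (simp only: cis_multiple_2pi[OF Ints_of_int])
qed

lemma add_char_cong:
  assumes "q > 0" "[x = y] (mod int q)"
  shows "add_char q x = add_char q y"
proof -
  have "add_char q (x - y) = 1"
    using assms by (simp add: add_char_eq_1_iff cong_iff_dvd_diff)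
  then show ?thesis
    using add_char_add[of q "x - y" y] by simp
qed

lemma add_char_mult_cancel:
  assumes "M > 0"
  shows "add_char (M * Q) (int M * z) = add_char Q z"
  using assms by (simp add: add_char_def mult.assoc)

lemma sum_add_char:
  assumes "q > 0"
  shows "(\<Sum>x\<in>{0..<int q}. add_char q (x * z)) = (if int q dvd z then of_nat q else 0)"
proof -
  have pow: "add_char q (int n * z) = add_char q z ^ n" for n
    by (induction n) (simp_all add: ring_distribs add_char_add)
  have "(\<Sum>x\<in>{0..<int q}. add_char q (x * z)) = (\<Sum>n<q. add_char q (int n * z))"
    by (rule sum.reindex_bij_witness[of _ int nat]) auto
  also have "\<dots> = (\<Sum>n<q. add_char q z ^ n)"
    by (simp only: pow)
  also have "\<dots> = (if int q dvd z then of_nat q else 0)"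
  proof (cases "int q dvd z")
    case True
    then show ?thesis using assms by (simp add: add_char_eq_1_iff[THEN iffD2])
  next
    case False
    have "add_char q z ^ q = 1"
      using pow[of q] assms by (simp add: add_char_eq_1_iff[THEN iffD2] flip: pow)
    then show ?thesis
      using False assms by (simp add: geometric_sum add_char_eq_1_iff)
  qed
  finally show ?thesis .
qed

text \<open>Orthogonality in both variables leaves only pairs \<open>i\<close>, \<open>k\<close>
  whose two frequencies agree modulo \<open>Q\<close>; coefficients of modulus at most 1 then drop
  out by the triangle inequality.\<close>

lemma parseval_bound:
  fixes c :: "'i \<Rightarrow> complex" and s s' :: "'i \<Rightarrow> int"
  assumes "Q > 0" "finite I" "\<And>i. i \<in> I \<Longrightarrow> norm (c i) \<le> 1"
  shows "(\<Sum>x\<in>{0..<int Q}. \<Sum>y\<in>{0..<int Q}. (norm (\<Sum>i\<in>I. c i * add_char Q (x * s i + y * s' i)))\<^sup>2)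
    \<le> (real Q)\<^sup>2 * (\<Sum>i\<in>I. \<Sum>k\<in>I. of_bool (int Q dvd s i - s k \<and> int Q dvd s' i - s' k))"
    (is "?L \<le> ?R")
proof -
  have sq: "of_real ((norm (\<Sum>i\<in>I. c i * add_char Q (x * s i + y * s' i)))\<^sup>2) =
      (\<Sum>i\<in>I. \<Sum>k\<in>I. c i * cnj (c k) * (add_char Q (x * (s i - s k)) * add_char Q (y * (s' i - s' k))))" for x y
    unfolding complex_norm_square
    by (simp add: sum_product cnj_sum add_char_add add_char_diff right_diff_distrib algebra_simps)
  have "of_real ?L = (\<Sum>x\<in>{0..<int Q}. \<Sum>y\<in>{0..<int Q}. \<Sum>i\<in>I. \<Sum>k\<in>I.
      c i * cnj (c k) * (add_char Q (x * (s i - s k)) * add_char Q (y * (s' i - s' k))))"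
    by (simp only: of_real_sum sq)
  also have "\<dots> = (\<Sum>x\<in>{0..<int Q}. \<Sum>i\<in>I. \<Sum>k\<in>I. \<Sum>y\<in>{0..<int Q}.
      c i * cnj (c k) * (add_char Q (x * (s i - s k)) * add_char Q (y * (s' i - s' k))))"
    by (simp only: sum.swap[of _ I "{0..<int Q}"])
  also have "\<dots> = (\<Sum>i\<in>I. \<Sum>k\<in>I. \<Sum>x\<in>{0..<int Q}. \<Sum>y\<in>{0..<int Q}.
      c i * cnj (c k) * (add_char Q (x * (s i - s k)) * add_char Q (y * (s' i - s' k))))"
    by (simp only: sum.swap[of _ "{0..<int Q}" I])
  also have "\<dots> = (\<Sum>i\<in>I. \<Sum>k\<in>I. c i * cnj (c k) *
      ((\<Sum>x\<in>{0..<int Q}. add_char Q (x * (s i - s k))) * (\<Sum>y\<in>{0..<int Q}. add_char Q (y * (s' i - s' k)))))"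
    by (simp only: sum_product) (simp only: sum_distrib_left)
  also have "\<dots> = (\<Sum>i\<in>I. \<Sum>k\<in>I. c i * cnj (c k) *
      ((of_nat Q)\<^sup>2 * of_bool (int Q dvd s i - s k \<and> int Q dvd s' i - s' k)))"
    using assms(1) by (intro sum.cong refl) (simp add: sum_add_char power2_eq_square)
  finally have eq: "complex_of_real ?L = \<dots>" .
  have "?L \<le> norm (complex_of_real ?L)"
    by (simp only: norm_of_real abs_ge_self)
  also have "\<dots> \<le> (\<Sum>i\<in>I. \<Sum>k\<in>I. norm (c i * cnj (c k) *
      ((of_nat Q)\<^sup>2 * of_bool (int Q dvd s i - s k \<and> int Q dvd s' i - s' k))))"
    unfolding eq by (intro order_trans[OF norm_sum] sum_mono norm_sum)
  also have "\<dots> \<le> (\<Sum>i\<in>I. \<Sum>k\<in>I.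
      (real Q)\<^sup>2 * of_bool (int Q dvd s i - s k \<and> int Q dvd s' i - s' k))"
  proof (intro sum_mono)
    fix i k assume ik: "i \<in> I" "k \<in> I"
    have "norm (c i * cnj (c k)) \<le> 1"
      using mult_mono[OF assms(3)[OF ik(1)] assms(3)[OF ik(2)]] by (simp add: norm_mult)
    define b :: real where
      "b = (real Q)\<^sup>2 * of_bool (int Q dvd s i - s k \<and> int Q dvd s' i - s' k)"
    have "norm (c i * cnj (c k) * of_real b) \<le> 1 * b"
      unfolding norm_mult[of "c i * cnj (c k)"] norm_of_real
      using \<open>norm (c i * cnj (c k)) \<le> 1\<close> by (intro mult_mono) (auto simp: b_def)
    moreover have "(of_nat Q)\<^sup>2 * of_bool (int Q dvd s i - s k \<and> int Q dvd s' i - s' k) = complex_of_real b"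
      by (simp add: b_def)
    ultimately show "norm (c i * cnj (c k) *
      ((of_nat Q)\<^sup>2 * of_bool (int Q dvd s i - s k \<and> int Q dvd s' i - s' k))) \<le>
       (real Q)\<^sup>2 * of_bool (int Q dvd s i - s k \<and> int Q dvd s' i - s' k)"
      by (simp only: b_def)
  qed
  also have "\<dots> = ?R"
    by (simp add: sum_distrib_left)
  finally show ?thesis .
qed

section \<open>Kloosterman sums\<close>

text \<open>Each unit is stored with its inverse, which avoids an inverse function and makes
  Kloosterman sums visibly symmetric in their arguments.\<close>

definition hyperbola :: "nat \<Rightarrow> (int \<times> int) set" where
  "hyperbola q = {(t, s). t \<in> {0..<int q} \<and> s \<in> {0..<int q} \<and> [t * s = 1] (mod int q)}"

definition kloosterman :: "nat \<Rightarrow> int \<Rightarrow> int \<Rightarrow> complex" where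
  "kloosterman q u v = (\<Sum>z\<in>hyperbola q. add_char q (u * fst z + v * snd z))"

lemma finite_hyperbola [simp]: "finite (hyperbola q)"
  by (rule finite_subset[of _ "{0..<int q} \<times> {0..<int q}"]) (auto simp: hyperbola_def)

lemma card_hyperbola_pos:
  assumes "q > 0"
  shows "card (hyperbola q) > 0"
proof -
  \<comment> \<open>Reducing 1 keeps the witness in range for \<open>q = 1\<close> too.\<close>
  have "(1 mod int q, 1 mod int q) \<in> hyperbola q"
    using assms by (auto simp: hyperbola_def cong_def mod_mult_eq)
  then show ?thesis
    using finite_hyperbola card_gt_0_iff by blast
qed

lemma norm_kloosterman_le: "norm (kloosterman q u v) \<le> card (hyperbola q)"
  unfolding kloosterman_def by (rule order_trans[OF norm_sum]) simp

lemma kloosterman_swap: "kloosterman q u v = kloosterman q v u"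
  unfolding kloosterman_def
  by (rule sum.reindex_bij_witness[of _ prod.swap prod.swap])
    (auto simp: hyperbola_def mult.commute add.commute)

lemma kloosterman_cong:
  assumes "q > 0" "[u = u'] (mod int q)" "[v = v'] (mod int q)"
  shows "kloosterman q u v = kloosterman q u' v'"
  unfolding kloosterman_def
  by (intro sum.cong refl add_char_cong assms cong_add cong_mult) auto

section \<open>Units acting on the hyperbola\<close>

lemma bij_betw_hyperbola:
  assumes "q > 0" "[w * w' = 1] (mod int q)"
  shows "bij_betw (\<lambda>z. (w * fst z mod int q, w' * snd z mod int q)) (hyperbola q) (hyperbola q)"
proof (rule bij_betw_byWitness[where f' = "\<lambda>z. (w' * fst z mod int q, w * snd z mod int q)"])
  have inv: "a * (b * t mod int q) mod int q = t"
    if "[a * b = 1] (mod int q)" "t \<in> {0..<int q}" for a b t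
  proof -
    have "[a * (b * t mod int q) = a * b * t] (mod int q)"
      by (simp add: cong_def mod_simps mult.assoc)
    also have "[a * b * t = 1 * t] (mod int q)"
      by (intro cong_mult that cong_refl)
    finally show ?thesis
      using that(2) by (simp add: cong_def)
  qed
  have "[w' * w = 1] (mod int q)"
    using assms(2) by (simp add: mult.commute)
  then show "\<forall>z\<in>hyperbola q. (w' * fst (w * fst z mod int q, w' * snd z mod int q) mod int q,
      w * snd (w * fst z mod int q, w' * snd z mod int q) mod int q) = z"
    "\<forall>z\<in>hyperbola q. (w * fst (w' * fst z mod int q, w * snd z mod int q) mod int q,
      w' * snd (w' * fst z mod int q, w * snd z mod int q) mod int q) = z"
    using assms(2) by (auto simp: hyperbola_def inv)
  have mem: "(a * t mod int q, b * s mod int q) \<in> hyperbola q"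
    if "[a * b = 1] (mod int q)" "(t, s) \<in> hyperbola q" for a b t s
  proof -
    have "[(a * b) * (t * s) = 1 * 1] (mod int q)"
      using that by (intro cong_mult) (auto simp: hyperbola_def)
    then have "[(a * t) * (b * s) = 1] (mod int q)"
      by (simp add: mult_ac)
    moreover have "[(a * t mod int q) * (b * s mod int q) = (a * t) * (b * s)] (mod int q)"
      by (intro cong_mult) auto
    ultimately show ?thesis
      using assms(1) by (auto simp: hyperbola_def intro: cong_trans)
  qed
  show "(\<lambda>z. (w * fst z mod int q, w' * snd z mod int q)) ` hyperbola q \<subseteq> hyperbola q"
    using mem[OF assms(2)] by auto
  show "(\<lambda>z. (w' * fst z mod int q, w * snd z mod int q)) ` hyperbola q \<subseteq> hyperbola q"
    using mem[OF \<open>[w' * w = 1] (mod int q)\<close>] by auto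
qed

lemma kloosterman_act:
  assumes "q > 0" "[w * w' = 1] (mod int q)"
  shows "kloosterman q (u * w) (v * w') = kloosterman q u v"
proof -
  have "kloosterman q u v = (\<Sum>z\<in>hyperbola q. add_char q (u * (w * fst z mod int q) + v * (w' * snd z mod int q)))"
    unfolding kloosterman_def by (subst sum.reindex_bij_betw[OF bij_betw_hyperbola[OF assms], symmetric]) simp
  also have "\<dots> = kloosterman q (u * w) (v * w')"
    unfolding kloosterman_def
    unfolding mult.assoc
    by (intro sum.cong refl add_char_cong assms cong_add cong_mult) auto
  finally show ?thesis ..
qed

text \<open>Chinese remainder theorem. Such a unit alters only the \<open>p\<close>-part, so one
  prime can be isolated without factoring the Kloosterman sum.\<close>

lemma unit_lift:
  fixes c :: int
  assumes "prime p" "q = p ^ k * q'" "\<not> p dvd q'" "\<not> int p dvd c"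
  obtains w w' where "[w * w' = 1] (mod int q)" "[w = c] (mod int (p ^ k))"
    "[w = 1] (mod int q')" "[w' = 1] (mod int q')"
proof -
  have cop: "coprime (int (p ^ k)) (int q')"
    using assms(1,3) by (simp add: prime_imp_coprime)
  obtain w where w: "[w = c] (mod int (p ^ k))" "[w = 1] (mod int q')"
    using binary_chinese_remainder_int[OF cop] by blast
  have "coprime c (int (p ^ k))"
    using assms(1,4) prime_imp_coprime[of "int p" c] by (simp add: coprime_commute)
  then have "coprime w (int (p ^ k))"
    using w(1) by (metis cong_imp_coprime cong_sym)
  moreover have "coprime w (int q')"
    using w(2) by (metis cong_imp_coprime cong_sym coprime_1_left)
  ultimately have "coprime w (int q)"
    using assms(2) by simp
  then obtain w' where w': "[w * w' = 1] (mod int q)"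
    by (meson cong_solve_coprime_int)
  then have "[w * w' = 1] (mod int q')"
    by (rule cong_dvd_mono_modulus) (simp add: assms(2))
  moreover have "[w * w' = 1 * w'] (mod int q')"
    by (intro cong_mult w cong_refl)
  ultimately have "[w' = 1] (mod int q')"
    by (metis cong_sym cong_trans mult_1)
  with w w' show ?thesis using that by blast
qed

text \<open>Lift the \<open>totient (p ^ i)\<close> units modulo \<open>p ^ i\<close> to units
  modulo \<open>q\<close>. The lift of \<open>r\<close> moves the class of \<open>c\<close> into the
  class of \<open>r * c\<close>; for \<open>c\<close> prime to \<open>p\<close> these images are
  disjoint and of equal size. If \<open>p\<close> divides \<open>c\<close>, the class is
  empty.\<close>

lemma card_hyperbola_class:
  fixes c :: int
  assumes "prime p" "q = p ^ k * q'" "\<not> p dvd q'" "0 < i" "i \<le> k"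
  shows "card {z \<in> hyperbola q. [fst z = c] (mod int (p ^ i))} * totient (p ^ i) \<le> card (hyperbola q)"
proof (cases "int p dvd c")
  case True
  have pq: "int p dvd int q"
    using assms by (simp add: dvd_power)
  have "{z \<in> hyperbola q. [fst z = c] (mod int (p ^ i))} = {}"
  proof (rule equals0I)
    fix z assume z: "z \<in> {z \<in> hyperbola q. [fst z = c] (mod int (p ^ i))}"
    have "int p dvd int (p ^ i)"
      using assms by (simp add: dvd_power)
    then have "[fst z = c] (mod int p)"
      using z cong_dvd_mono_modulus by blast
    then have "int p dvd fst z"
      using True by (simp add: cong_dvd_iff)
    moreover have "[fst z * snd z = 1] (mod int p)"
      using z pq by (auto simp: hyperbola_def intro: cong_dvd_mono_modulus)
    ultimately have "int p dvd 1"
      by (metis cong_dvd_iff dvd_mult2)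
    then show False
      using assms(1) by (simp add: prime_nat_iff)
  qed
  then show ?thesis by (metis card.empty mult_zero_left zero_le)
next
  case False
  define C where "C = {z \<in> hyperbola q. [fst z = c] (mod int (p ^ i))}"
  have pi: "p ^ i > 1"
    using one_less_power[OF prime_gt_1_nat[OF assms(1)] assms(4)] .
  have q: "q > 0"
    using assms(1-3) by (cases "q' = 0") (auto simp: prime_gt_0_nat)
  have "\<exists>w w'. [w * w' = 1] (mod int q) \<and> [w = int r] (mod int (p ^ k))"
    if "r \<in> totatives (p ^ i)" for r
  proof -
    have "coprime p r"
      using that assms by (simp add: totatives_def coprime_commute)
    then have "\<not> int p dvd int r"
      using assms(1) by (metis coprime_absorb_left int_dvd_int_iff not_prime_unit)
    then show ?thesis
      using unit_lift[OF assms(1-3)] by metis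
  qed
  then obtain W W' where W: "\<And>r. r \<in> totatives (p ^ i) \<Longrightarrow> [W r * W' r = 1] (mod int q)"
    "\<And>r. r \<in> totatives (p ^ i) \<Longrightarrow> [W r = int r] (mod int (p ^ k))"
    by metis
  define act where "act r z = (W r * fst z mod int q, W' r * snd z mod int q)" for r z
  have act: "bij_betw (act r) (hyperbola q) (hyperbola q)" if "r \<in> totatives (p ^ i)" for r
    unfolding act_def[abs_def] using bij_betw_hyperbola[OF q W(1)[OF that]] .
  note act_inj = bij_betw_imp_inj_on[OF act]
  have "inj_on (\<lambda>(r, z). act r z) (totatives (p ^ i) \<times> C)"
  proof (rule inj_onI)
    fix x y
    assume xy: "x \<in> totatives (p ^ i) \<times> C" "y \<in> totatives (p ^ i) \<times> C"
      "(\<lambda>(r, z). act r z) x = (\<lambda>(r, z). act r z) y"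
    obtain r t s where x: "x = (r, t, s)" by (cases x)
    obtain r' t' s' where y: "y = (r', t', s')" by (cases y)
    have r: "r \<in> totatives (p ^ i)" "r' \<in> totatives (p ^ i)"
      and z: "(t, s) \<in> C" "(t', s') \<in> C" and eq: "act r (t, s) = act r' (t', s')"
      using xy by (auto simp: x y)
    have res: "[W r * t mod int q = int r * c] (mod int (p ^ i))"
      if "r \<in> totatives (p ^ i)" "(t, s) \<in> C" for r t s
    proof -
      have "int (p ^ i) dvd int (p ^ k)"
        using assms(5) by (simp add: le_imp_power_dvd)
      then have "[W r = int r] (mod int (p ^ i))"
        using W(2)[OF that(1)] cong_dvd_mono_modulus by blast
      then have "[W r * t = int r * c] (mod int (p ^ i))"
        using that(2) by (intro cong_mult) (auto simp: C_def)
      moreover have "[W r * t mod int q = W r * t] (mod int (p ^ i))"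
        by (rule cong_dvd_mono_modulus[of _ _ "int q"])
          (use assms(2,5) in \<open>auto simp: le_imp_power_dvd\<close>)
      ultimately show ?thesis
        using cong_trans by blast
    qed
    have "[int r * c = int r' * c] (mod int (p ^ i))"
      using res[OF r(1) z(1)] res[OF r(2) z(2)] eq unfolding act_def
      by (metis cong_sym cong_trans fst_conv prod.inject)
    moreover have "coprime c (int (p ^ i))"
      using assms(1) False prime_imp_coprime[of "int p" c] by (simp add: coprime_commute)
    ultimately have "[int r = int r'] (mod int (p ^ i))"
      by (simp add: cong_mult_rcancel)
    then have "[r = r'] (mod p ^ i)"
      by (simp only: cong_int_iff)
    then have rr: "r = r'"
      by (rule cong_less_modulus_unique_nat[OF _ totatives_less[OF r(1) pi] totatives_less[OF r(2) pi]])
    have "act r (t, s) = act r (t', s')"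
      using eq unfolding rr .
    moreover have "(t, s) \<in> hyperbola q" "(t', s') \<in> hyperbola q"
      using z unfolding C_def by blast+
    ultimately have "(t, s) = (t', s')"
      by (rule inj_onD[OF act_inj[OF r(1)]])
    with rr show "x = y" by (simp add: x y)
  qed
  moreover have "(\<lambda>(r, z). act r z) ` (totatives (p ^ i) \<times> C) \<subseteq> hyperbola q"
  proof (rule image_subsetI)
    fix x assume "x \<in> totatives (p ^ i) \<times> C"
    then have "fst x \<in> totatives (p ^ i)" "snd x \<in> hyperbola q"
      by (auto simp: C_def)
    then show "(\<lambda>(r, z). act r z) x \<in> hyperbola q"
      using bij_betwE[OF act] by (simp add: case_prod_unfold)
  qed
  ultimately have "card (totatives (p ^ i) \<times> C) \<le> card (hyperbola q)"
    by (rule card_inj_on_le) simp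
  then show ?thesis
    by (simp add: card_cartesian_product totient_def C_def mult.commute)
qed

section \<open>Additive energy of the hyperbola modulo a prime power\<close>

lemma prime_power_dvd_triple:
  fixes p x y z :: int
  assumes "prime p" "p ^ j dvd x * y * z" "0 < i" "3 * i < j + 3"
  shows "p ^ i dvd x \<or> p ^ i dvd y \<or> p ^ i dvd z"
proof -
  \<comment> \<open>Three valuations of at most \<open>i - 1\<close> add up to at most
    \<open>3 * i - 3 < j\<close>; hence \<open>3 * i - 2\<close> is the exponent to split, in two
    stages.\<close>
  have "p ^ (3 * i - 2) dvd x * (y * z)"
    using dvd_trans[OF le_imp_power_dvd[of "3 * i - 2" j p] assms(2)] assms(4)
    by (simp add: mult.assoc)
  then have "p ^ i dvd x \<or> p ^ (2 * i - 1) dvd y * z"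
    using assms by (intro prime_elem_power_dvd_cases[of p "3 * i - 2"]) auto
  moreover have "p ^ i dvd y \<or> p ^ i dvd z" if "p ^ (2 * i - 1) dvd y * z"
    using assms that by (intro prime_elem_power_dvd_cases[of p "2 * i - 1"]) auto
  ultimately show ?thesis by blast
qed

text \<open>Modulo \<open>Q\<close> put \<open>S = t3 + t4\<close>. Equal sums of inverses say
  \<open>S / (t1 t2) = S / (t3 t4)\<close>, so \<open>S (t3 t4 - t1 t2) = 0\<close>, and
  \<open>t2 = S - t1\<close> turns the bracket into \<open>(t3 - t1) (t4 - t1)\<close>. The identity
  in the proof is this computation without denominators.\<close>

lemma hyperbola_pair_dvd:
  fixes t1 t2 t3 t4 s1 s2 s3 s4 Q :: int
  assumes "Q dvd t1 * s1 - 1" "Q dvd t2 * s2 - 1" "Q dvd t3 * s3 - 1" "Q dvd t4 * s4 - 1"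
    and "Q dvd t1 + t2 - (t3 + t4)" "Q dvd s1 + s2 - (s3 + s4)"
  shows "Q dvd (t3 + t4) * (t3 - t1) * (t4 - t1)"
proof -
  have "(t3 + t4) * (t3 - t1) * (t4 - t1) =
      t1 * t2 * t3 * t4 * (s1 + s2 - (s3 + s4))
      - (t1 * s1 - 1) * (t2 * t3 * t4) - (t2 * s2 - 1) * (t1 * t3 * t4)
      + (t3 * s3 - 1) * (t1 * t2 * t4) + (t4 * s4 - 1) * (t1 * t2 * t3)
      + (t1 + t2 - (t3 + t4)) * (t1 * (t3 + t4) - t3 * t4)"
    by (simp add: algebra_simps)
  moreover have "Q dvd \<dots>"
    by (intro dvd_add dvd_diff dvd_mult2[OF assms(1)] dvd_mult2[OF assms(2)] dvd_mult2[OF assms(3)]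
      dvd_mult2[OF assms(4)] dvd_mult2[OF assms(5)] dvd_mult[OF assms(6)])
  ultimately show ?thesis by (simp only:)
qed

lemma of_bool_le_mult:
  assumes "P \<Longrightarrow> (A \<or> B \<or> C) \<and> D"
  shows "of_bool P \<le> (of_bool A + of_bool B + of_bool C) * (of_bool D :: real)"
  using assms by (cases P; cases A; cases B; cases C; cases D) auto

text \<open>The additive energy of the hyperbola reduced modulo \<open>Q\<close>, written as a sum
  of indicators to match the right-hand side of \<open>parseval_bound\<close>.\<close>

definition hyperbola_energy :: "nat \<Rightarrow> nat \<Rightarrow> real" where
  "hyperbola_energy q Q = (\<Sum>z\<in>hyperbola q \<times> hyperbola q. \<Sum>z'\<in>hyperbola q \<times> hyperbola q.
     of_bool (int Q dvd fst (fst z) + fst (snd z) - (fst (fst z') + fst (snd z')) \<and>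
       int Q dvd snd (fst z) + snd (snd z) - (snd (fst z') + snd (snd z'))))"

text \<open>By \<open>hyperbola_pair_dvd\<close> a coincidence modulo \<open>p ^ j\<close> forces
  one of three congruences modulo \<open>p ^ i\<close> among the first coordinates of
  \<open>z1\<close>, \<open>z3\<close>, \<open>z4\<close>, and these points fix that of
  \<open>z2\<close> modulo \<open>p ^ j\<close>. Each of the two conditions saves a totient factor
  by \<open>card_hyperbola_class\<close>.\<close>

lemma hyperbola_energy_le:
  assumes "prime p" "q = p ^ k * q'" "\<not> p dvd q'" "0 < i" "i \<le> j" "j \<le> k" "3 * i < j + 3"
  shows "hyperbola_energy q (p ^ j) * (totient (p ^ i) * totient (p ^ j)) \<le> 3 * real (card (hyperbola q)) ^ 4"
proof -
  define H where "H = hyperbola q"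
  define N where "N = real (card H)"
  define \<phi> where "\<phi> l = real (totient (p ^ l))" for l
  have p0: "p > 0" using assms(1) by (simp add: prime_gt_0_nat)
  have \<phi>: "\<phi> l > 0" for l
    using p0 by (simp add: \<phi>_def)
  have cls: "(\<Sum>z\<in>H. of_bool (int (p ^ l) dvd fst z - c)) \<le> N / \<phi> l"
    if "0 < l" "l \<le> k" for l and c :: int
  proof -
    have "(\<Sum>z\<in>H. of_bool (int (p ^ l) dvd fst z - c)) =
        real (card {z \<in> H. [fst z = c] (mod int (p ^ l))})"
      by (simp add: H_def sum.If_cases of_bool_def cong_iff_dvd_diff Int_def)
    also have "\<dots> \<le> N / \<phi> l"
      using card_hyperbola_class[OF assms(1-3) that, of c] \<phi>[of l]
      unfolding N_def \<phi>_def H_def by (simp only: pos_le_divide_eq of_nat_le_iff flip: of_nat_mult)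
    finally show ?thesis .
  qed
  have "hyperbola_energy q (p ^ j) = (\<Sum>z1\<in>H. \<Sum>z2\<in>H. \<Sum>z3\<in>H. \<Sum>z4\<in>H.
      of_bool (int (p ^ j) dvd fst z1 + fst z2 - (fst z3 + fst z4) \<and>
        int (p ^ j) dvd snd z1 + snd z2 - (snd z3 + snd z4)))"
    unfolding hyperbola_energy_def H_def[symmetric]
    by (simp only: sum.cartesian_product' fst_conv snd_conv)
  also have "\<dots> \<le> (\<Sum>z1\<in>H. \<Sum>z2\<in>H. \<Sum>z3\<in>H. \<Sum>z4\<in>H.
      (of_bool (int (p ^ i) dvd fst z3 - fst z1) + of_bool (int (p ^ i) dvd fst z4 - fst z1)
        + of_bool (int (p ^ i) dvd fst z3 - (- fst z4)))
      * of_bool (int (p ^ j) dvd fst z2 - (fst z3 + fst z4 - fst z1)))"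
  proof (intro sum_mono)
    fix z1 z2 z3 z4 assume z: "z1 \<in> H" "z2 \<in> H" "z3 \<in> H" "z4 \<in> H"
    show "of_bool (int (p ^ j) dvd fst z1 + fst z2 - (fst z3 + fst z4) \<and>
        int (p ^ j) dvd snd z1 + snd z2 - (snd z3 + snd z4)) \<le>
      (of_bool (int (p ^ i) dvd fst z3 - fst z1) + of_bool (int (p ^ i) dvd fst z4 - fst z1)
        + of_bool (int (p ^ i) dvd fst z3 - (- fst z4)))
      * (of_bool (int (p ^ j) dvd fst z2 - (fst z3 + fst z4 - fst z1)) :: real)"
    proof (rule of_bool_le_mult)
      assume True: "int (p ^ j) dvd fst z1 + fst z2 - (fst z3 + fst z4) \<and>
        int (p ^ j) dvd snd z1 + snd z2 - (snd z3 + snd z4)"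
      have "int (p ^ j) dvd int q"
        using assms(2,6) by (simp add: le_imp_power_dvd)
      then have "int (p ^ j) dvd fst z * snd z - 1" if "z \<in> H" for z
        using dvd_trans[of "int (p ^ j)" "int q" "fst z * snd z - 1"] that
        by (simp add: H_def hyperbola_def cong_iff_dvd_diff split: prod.splits)
      then have "int (p ^ j) dvd (fst z3 + fst z4) * (fst z3 - fst z1) * (fst z4 - fst z1)"
        using hyperbola_pair_dvd[of "int (p ^ j)" "fst z1" "snd z1" "fst z2" "snd z2" "fst z3" "snd z3" "fst z4" "snd z4"]
          True z by blast
      then have "int (p ^ i) dvd fst z3 + fst z4 \<or> int (p ^ i) dvd fst z3 - fst z1 \<or> int (p ^ i) dvd fst z4 - fst z1"
        using prime_power_dvd_triple[of "int p" j "fst z3 + fst z4" "fst z3 - fst z1" "fst z4 - fst z1" i] assms(1,4,7)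
        by simp
      moreover have "fst z2 - (fst z3 + fst z4 - fst z1) = fst z1 + fst z2 - (fst z3 + fst z4)"
        by simp
      ultimately show "(int (p ^ i) dvd fst z3 - fst z1 \<or> int (p ^ i) dvd fst z4 - fst z1 \<or>
          int (p ^ i) dvd fst z3 - (- fst z4)) \<and> int (p ^ j) dvd fst z2 - (fst z3 + fst z4 - fst z1)"
        using True by (simp only: diff_minus_eq_add) blast
    qed
  qed
  also have "\<dots> = (\<Sum>z1\<in>H. \<Sum>z3\<in>H. \<Sum>z4\<in>H.
      (of_bool (int (p ^ i) dvd fst z3 - fst z1) + of_bool (int (p ^ i) dvd fst z4 - fst z1)
        + of_bool (int (p ^ i) dvd fst z3 - (- fst z4)))
      * (\<Sum>z2\<in>H. of_bool (int (p ^ j) dvd fst z2 - (fst z3 + fst z4 - fst z1))))"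
  proof -
    have "(\<Sum>z2\<in>H. \<Sum>z3\<in>H. \<Sum>z4\<in>H. f z2 z3 z4) = (\<Sum>z3\<in>H. \<Sum>z4\<in>H. \<Sum>z2\<in>H. f z2 z3 z4)"
      for f :: "_ \<Rightarrow> _ \<Rightarrow> _ \<Rightarrow> real"
      by (subst sum.swap, rule sum.cong[OF refl], rule sum.swap)
    from this show ?thesis
      unfolding sum_distrib_left by (rule sum.cong[OF refl])
  qed
  also have "\<dots> \<le> (\<Sum>z1\<in>H. \<Sum>z3\<in>H. \<Sum>z4\<in>H.
      (of_bool (int (p ^ i) dvd fst z3 - fst z1) + of_bool (int (p ^ i) dvd fst z4 - fst z1)
        + of_bool (int (p ^ i) dvd fst z3 - (- fst z4))) * (N / \<phi> j))"
    using assms(4-6) by (intro sum_mono mult_left_mono cls) simp_all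
  also have "\<dots> \<le> (\<Sum>z1\<in>H. (\<Sum>z\<in>H. N / \<phi> i) + (\<Sum>z\<in>H. N / \<phi> i) + (\<Sum>z\<in>H. N / \<phi> i)) * (N / \<phi> j)"
  proof -
    have swapped: "(\<Sum>z3\<in>H. \<Sum>z4\<in>H. of_bool (int (p ^ i) dvd fst z3 - c z4)) \<le> (\<Sum>z\<in>H. N / \<phi> i)"
      for c :: "int \<times> int \<Rightarrow> int"
      by (subst sum.swap) (use assms in \<open>intro sum_mono cls, auto\<close>)
    have "(\<Sum>z3\<in>H. \<Sum>z4\<in>H. of_bool (int (p ^ i) dvd fst z4 - c)) \<le> (\<Sum>z\<in>H. N / \<phi> i)" for c
      using assms by (intro sum_mono cls) auto
    then have "(\<Sum>z3\<in>H. \<Sum>z4\<in>H. of_bool (int (p ^ i) dvd fst z3 - fst z1)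
        + of_bool (int (p ^ i) dvd fst z4 - fst z1) + of_bool (int (p ^ i) dvd fst z3 - (- fst z4)))
      \<le> (\<Sum>z\<in>H. N / \<phi> i) + (\<Sum>z\<in>H. N / \<phi> i) + (\<Sum>z\<in>H. N / \<phi> i)" for z1 :: "int \<times> int"
      unfolding sum.distrib by (intro add_mono swapped)
    then have "(\<Sum>z1\<in>H. \<Sum>z3\<in>H. \<Sum>z4\<in>H. of_bool (int (p ^ i) dvd fst z3 - fst z1)
        + of_bool (int (p ^ i) dvd fst z4 - fst z1) + of_bool (int (p ^ i) dvd fst z3 - (- fst z4)))
      \<le> (\<Sum>z1\<in>H. (\<Sum>z\<in>H. N / \<phi> i) + (\<Sum>z\<in>H. N / \<phi> i) + (\<Sum>z\<in>H. N / \<phi> i))"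
      by (rule sum_mono)
    moreover have "0 \<le> N / \<phi> j"
      using \<phi>[of j] by (simp add: N_def)
    ultimately show ?thesis
      unfolding sum_distrib_right[symmetric] by (rule mult_right_mono)
  qed
  also have "\<dots> = 3 * N ^ 4 / (\<phi> i * \<phi> j)"
    by (simp add: N_def[symmetric] power4_eq_xxxx)
  finally have "hyperbola_energy q (p ^ j) \<le> 3 * N ^ 4 / (\<phi> i * \<phi> j)" .
  moreover have "0 < \<phi> i * \<phi> j"
    using \<phi> by simp
  ultimately show ?thesis
    by (simp only: pos_le_divide_eq N_def H_def \<phi>_def of_nat_mult)
qed

section \<open>Fourth moment of shifted Kloosterman sums and the local bound\<close>

lemma kloosterman_fourth_moment:
  assumes "q = M * Q" "q > 0"
  shows "(\<Sum>x\<in>{0..<int Q}. \<Sum>y\<in>{0..<int Q}. norm (kloosterman q (u + int M * x) (v + int M * y)) ^ 4)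
    \<le> (real Q)\<^sup>2 * hyperbola_energy q Q"
proof -
  define I where "I = hyperbola q \<times> hyperbola q"
  define c where "c z = add_char q (u * (fst (fst z) + fst (snd z)) + v * (snd (fst z) + snd (snd z)))"
    for z :: "(int \<times> int) \<times> int \<times> int"
  have pos: "M > 0" "Q > 0"
    using assms by auto
  \<comment> \<open>The square is a sum over pairs of points. As \<open>q = M * Q\<close>, shifts by
    multiples of \<open>M\<close> become characters modulo \<open>Q\<close>, while \<open>u\<close>
    and \<open>v\<close> enter only through the unimodular \<open>c z\<close>.\<close>
  have "kloosterman q (u + int M * x) (v + int M * y) ^ 2 =
      (\<Sum>z\<in>I. c z * add_char Q (x * (fst (fst z) + fst (snd z)) + y * (snd (fst z) + snd (snd z))))" for x y
  proof -
    have "kloosterman q (u + int M * x) (v + int M * y) ^ 2 =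
      (\<Sum>z\<in>I. add_char q ((u + int M * x) * fst (fst z) + (v + int M * y) * snd (fst z))
        * add_char q ((u + int M * x) * fst (snd z) + (v + int M * y) * snd (snd z)))"
      unfolding power2_eq_square kloosterman_def I_def sum_product
      by (simp only: sum.cartesian_product' fst_conv snd_conv)
    also have "\<dots> = (\<Sum>z\<in>I. c z * add_char Q (x * (fst (fst z) + fst (snd z)) + y * (snd (fst z) + snd (snd z))))"
    proof (intro sum.cong refl)
      fix z :: "(int \<times> int) \<times> int \<times> int"
      have "add_char Q (x * (fst (fst z) + fst (snd z)) + y * (snd (fst z) + snd (snd z)))
          = add_char q (int M * (x * (fst (fst z) + fst (snd z)) + y * (snd (fst z) + snd (snd z))))"
        using add_char_mult_cancel[OF pos(1)] by (simp add: assms(1))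
      then show "add_char q ((u + int M * x) * fst (fst z) + (v + int M * y) * snd (fst z))
        * add_char q ((u + int M * x) * fst (snd z) + (v + int M * y) * snd (snd z)) =
        c z * add_char Q (x * (fst (fst z) + fst (snd z)) + y * (snd (fst z) + snd (snd z)))"
        unfolding c_def add_char_add[symmetric]
        by (auto simp only: add_char_add[symmetric] ring_distribs ac_simps)
    qed
    finally show ?thesis .
  qed
  then have sq: "norm (kloosterman q (u + int M * x) (v + int M * y)) ^ 4 =
      (norm (\<Sum>z\<in>I. c z * add_char Q (x * (fst (fst z) + fst (snd z)) + y * (snd (fst z) + snd (snd z)))))\<^sup>2" for x y
    by (metis norm_power power_mult mult_2 numeral_Bit0 power_add)
  show ?thesis
    unfolding sq hyperbola_energy_def I_def[symmetric]
    by (rule parseval_bound) (simp_all add: pos c_def I_def)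
qed

text \<open>
  The sum is constant along the orbit \<open>(u w, v w\<^sup>-\<^sup>1)\<close>. Units \<open>w \<equiv> 1\<close> modulo the \<open>p\<close>-free part of \<open>q\<close> move
  \<open>(u, v)\<close> only by multiples of \<open>q/p\<^sup>j\<close>, so this orbit injects into the range of the fourth moment.
\<close>

lemma kloosterman_orbit:
  assumes "prime p" "q = p ^ k * q'" "\<not> p dvd q'" "0 < j" "j \<le> k"
    and "u = int p ^ (k - j) * u'" "\<not> int p dvd u'" "v = int p ^ (k - j) * v'"
  shows "totient (p ^ j) * norm (kloosterman q u v) ^ 4 \<le> (real (p ^ j))\<^sup>2 * hyperbola_energy q (p ^ j)"
proof -
  define M where "M = p ^ (k - j) * q'"
  define Q where "Q = p ^ j"
  have qMQ: "q = M * Q"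
    using assms(2,5) by (simp add: M_def Q_def power_add[symmetric] mult_ac)
  have q: "q > 0"
    using assms(1-3) by (cases "q' = 0") (auto simp: prime_gt_0_nat)
  then have pos: "M > 0" "Q > 0" "q' > 0"
    using qMQ assms(3) by (auto intro!: Nat.gr0I)
  have Q1: "Q > 1"
    unfolding Q_def using one_less_power[OF prime_gt_1_nat[OF assms(1)] assms(4)] .
  have "\<exists>x y. x \<in> {0..<int Q} \<and> y \<in> {0..<int Q} \<and> [u' * int r = u' + int q' * x] (mod int Q) \<and>
      kloosterman q (u + int M * x) (v + int M * y) = kloosterman q u v" if "r \<in> totatives Q" for r
  proof -
    have "coprime (p ^ j) r"
      using that by (simp add: totatives_def coprime_commute Q_def)
    then have "coprime p r"
      using assms(4) by simp
    then have "\<not> int p dvd int r"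
      using assms(1) by (metis coprime_absorb_left int_dvd_int_iff not_prime_unit)
    then obtain w w' where w: "[w * w' = 1] (mod int q)" "[w = int r] (mod int (p ^ k))"
        "[w = 1] (mod int q')" "[w' = 1] (mod int q')"
      using unit_lift[OF assms(1-3)] by metis
    obtain a where a: "w - 1 = int q' * a"
      using w(3) by (auto simp: cong_iff_dvd_diff)
    obtain b where b: "w' - 1 = int q' * b"
      using w(4) by (auto simp: cong_iff_dvd_diff)
    \<comment> \<open>Both \<open>u\<close> and \<open>v\<close> contain \<open>p ^ (k - j)\<close>,
      so multiplying by a unit congruent to 1 modulo \<open>q'\<close> adds a multiple of
      \<open>M\<close>.\<close>
    have shift: "[s * (1 + int q' * c) = s + int M * ((s' * c) mod int Q)] (mod int q)"
      if "s = int p ^ (k - j) * s'" for s s' c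
    proof -
      have "s * (1 + int q' * c) = s + int M * (s' * c)"
        unfolding M_def that of_nat_mult of_nat_power distrib_left mult_1_right
        by (simp only: mult_ac)
      moreover have "[int M * (s' * c) = int M * ((s' * c) mod int Q)] (mod int q)"
        unfolding cong_iff_dvd_diff right_diff_distrib[symmetric] qMQ of_nat_mult
        by (intro mult_dvd_mono dvd_refl) (simp add: minus_mod_eq_mult_div)
      ultimately show ?thesis
        by (simp only: cong_add_lcancel)
    qed
    define x where "x = (u' * a) mod int Q"
    define y where "y = (v' * b) mod int Q"
    have ab: "w = 1 + int q' * a" "w' = 1 + int q' * b"
      using a b by (simp_all only: diff_eq_eq add.commute)
    have "kloosterman q (u + int M * x) (v + int M * y) = kloosterman q (u * w) (v * w')"
      unfolding x_def y_def ab by (intro kloosterman_cong q cong_sym[OF shift] assms)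
    also have "\<dots> = kloosterman q u v"
      by (rule kloosterman_act[OF q w(1)])
    finally have "kloosterman q (u + int M * x) (v + int M * y) = kloosterman q u v" .
    moreover have "[u' * int r = u' + int q' * x] (mod int Q)"
    proof -
      have "int Q dvd int (p ^ k)"
        using assms(5) by (simp add: Q_def le_imp_power_dvd)
      then have "[int r = w] (mod int Q)"
        using w(2) cong_dvd_mono_modulus cong_sym by blast
      then have "[u' * int r = u' * w] (mod int Q)"
        by (intro cong_mult cong_refl)
      also have "u' * w = u' + int q' * (u' * a)"
        by (simp add: ab ring_distribs)
      also have "[\<dots> = u' + int q' * x] (mod int Q)"
        unfolding x_def by (intro cong_add cong_mult cong_refl) auto
      finally show ?thesis .
    qed
    moreover have "x \<in> {0..<int Q}" "y \<in> {0..<int Q}"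
      using pos by (auto simp: x_def y_def)
    ultimately show ?thesis by blast
  qed
  then obtain X Y where XY: "\<And>r. r \<in> totatives Q \<Longrightarrow> X r \<in> {0..<int Q}"
      "\<And>r. r \<in> totatives Q \<Longrightarrow> Y r \<in> {0..<int Q}"
      "\<And>r. r \<in> totatives Q \<Longrightarrow> [u' * int r = u' + int q' * X r] (mod int Q)"
      "\<And>r. r \<in> totatives Q \<Longrightarrow> kloosterman q (u + int M * X r) (v + int M * Y r) = kloosterman q u v"
    by metis
  \<comment> \<open>As \<open>u'\<close> is prime to \<open>p\<close>, the shift \<open>X r\<close>
    alone determines \<open>r\<close> modulo \<open>p ^ j\<close>.\<close>
  have inj: "inj_on (\<lambda>r. (X r, Y r)) (totatives Q)"
  proof (rule inj_onI)
    fix r r' assume r: "r \<in> totatives Q" "r' \<in> totatives Q" and "(X r, Y r) = (X r', Y r')"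
    then have "[u' * int r = u' * int r'] (mod int Q)"
      using XY(3)[OF r(1)] XY(3)[OF r(2)] by (metis cong_sym cong_trans prod.inject)
    moreover have "coprime u' (int Q)"
      using assms(1,7) prime_imp_coprime[of "int p" u'] by (simp add: coprime_commute Q_def)
    ultimately have "[int r = int r'] (mod int Q)"
      by (simp add: cong_mult_lcancel)
    then have "[r = r'] (mod Q)"
      by (simp only: cong_int_iff)
    then show "r = r'"
      by (rule cong_less_modulus_unique_nat[OF _ totatives_less[OF r(1) Q1] totatives_less[OF r(2) Q1]])
  qed
  define G where "G z = norm (kloosterman q (u + int M * fst z) (v + int M * snd z)) ^ 4" for z
  have "totient Q * norm (kloosterman q u v) ^ 4 = (\<Sum>r\<in>totatives Q. G (X r, Y r))"
    by (simp add: G_def XY(4) totient_def)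
  also have "\<dots> = (\<Sum>z\<in>(\<lambda>r. (X r, Y r)) ` totatives Q. G z)"
    by (simp add: sum.reindex[OF inj])
  also have "\<dots> \<le> (\<Sum>z\<in>{0..<int Q} \<times> {0..<int Q}. G z)"
    using XY(1,2) by (intro sum_mono2) (auto simp: G_def)
  also have "\<dots> = (\<Sum>x\<in>{0..<int Q}. \<Sum>y\<in>{0..<int Q}. norm (kloosterman q (u + int M * x) (v + int M * y)) ^ 4)"
    by (simp only: sum.cartesian_product' G_def fst_conv snd_conv)
  also have "\<dots> \<le> (real Q)\<^sup>2 * hyperbola_energy q Q"
    by (rule kloosterman_fourth_moment[OF qMQ q])
  finally show ?thesis
    by (simp only: Q_def)
qed

lemma totient_prime_power_ge:
  assumes "prime p" "0 < i"
  shows "p ^ i \<le> 2 * totient (p ^ i)"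
proof -
  obtain n where n: "i = Suc n"
    using assms(2) gr0_implies_Suc by blast
  have "p \<le> 2 * (p - 1)"
    using prime_ge_2_nat[OF assms(1)] by simp
  then have "p ^ n * p \<le> p ^ n * (2 * (p - 1))"
    by (rule mult_le_mono2)
  then show ?thesis
    unfolding n totient_prime_power_Suc[OF assms(1)] unfolding power_Suc by (simp only: mult_ac)
qed

text \<open>Combine the orbit bound with the energy bound. Passing from totients to prime powers
  costs a factor 2 three times, hence \<open>24 = 3 * 2 ^ 3\<close>.\<close>

lemma kloosterman_local_bound:
  assumes "prime p" "q = p ^ k * q'" "\<not> p dvd q'" "0 < i" "i \<le> j" "j \<le> k" "3 * i < j + 3"
    and "u = int p ^ (k - j) * u'" "\<not> int p dvd u'" "v = int p ^ (k - j) * v'"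
  shows "norm (kloosterman q u v) ^ 4 * real (p ^ i) \<le> 24 * real (card (hyperbola q)) ^ 4"
proof -
  define K where "K = norm (kloosterman q u v) ^ 4"
  define N where "N = real (card (hyperbola q)) ^ 4"
  define P where "P = real (p ^ j)"
  define a where "a = real (totient (p ^ j))"
  define b where "b = real (totient (p ^ i))"
  have "a > 0" "b > 0"
    using prime_gt_0_nat[OF assms(1)] by (auto simp: a_def b_def)
  have Pa: "P \<le> 2 * a"
  proof -
    have "p ^ j \<le> 2 * totient (p ^ j)"
      using totient_prime_power_ge[OF assms(1)] assms(4,5) by simp
    then have "real (p ^ j) \<le> real (2 * totient (p ^ j))"
      by (simp only: of_nat_le_iff)
    then show ?thesis
      by (simp only: P_def a_def of_nat_mult of_nat_numeral)
  qed
  have pb: "real (p ^ i) \<le> 2 * b"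
  proof -
    have "real (p ^ i) \<le> real (2 * totient (p ^ i))"
      using totient_prime_power_ge[OF assms(1,4)] by (simp only: of_nat_le_iff)
    then show ?thesis
      by (simp only: b_def of_nat_mult of_nat_numeral)
  qed
  have P0: "P \<ge> 0" "K \<ge> 0" "N \<ge> 0"
    by (auto simp: P_def K_def N_def)
  have 1: "a * K \<le> P\<^sup>2 * hyperbola_energy q (p ^ j)"
    unfolding a_def K_def P_def
    using assms by (intro kloosterman_orbit[where k = k and q' = q' and u' = u' and v' = v']) auto
  have 2: "hyperbola_energy q (p ^ j) * (b * a) \<le> 3 * N"
    unfolding a_def b_def N_def using hyperbola_energy_le[OF assms(1-7)] by simp
  have "a\<^sup>2 * (K * b) = (a * K) * (b * a)"
    by (simp add: power2_eq_square)
  also have "\<dots> \<le> P\<^sup>2 * hyperbola_energy q (p ^ j) * (b * a)"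
    using 1 \<open>a > 0\<close> \<open>b > 0\<close> by (intro mult_right_mono) auto
  also have "\<dots> \<le> P\<^sup>2 * (3 * N)"
    using mult_left_mono[OF 2, of "P\<^sup>2"] by (simp add: mult.assoc)
  also have "\<dots> \<le> (2 * a)\<^sup>2 * (3 * N)"
    using Pa P0 by (intro mult_right_mono power_mono) auto
  also have "\<dots> = a\<^sup>2 * (12 * N)"
    by (simp add: power2_eq_square)
  finally have "K * b \<le> 12 * N"
    using \<open>a > 0\<close> by simp
  then have "K * (2 * b) \<le> 24 * N"
    by simp
  moreover have "K * real (p ^ i) \<le> K * (2 * b)"
    using pb P0 by (intro mult_left_mono)
  ultimately have "K * real (p ^ i) \<le> 24 * N"
    by linarith
  then show ?thesis
    by (simp only: K_def N_def)
qed

section \<open>Truncating the prime powers of an integer\<close>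

definition max_exponent :: "nat \<Rightarrow> nat \<Rightarrow> nat" where
  "max_exponent p N = (GREATEST j. p ^ j \<le> N)"

text \<open>With \<open>N = 2 ^ (51 * r)\<close> this is the \<open>R\<^sub>r\<close> of the opening
  comment. The exponents ignore the multiplicities in \<open>q\<close>, so the size is controlled by
  \<open>N\<close> and \<open>omega q\<close>; the cap need not divide \<open>q\<close>, and a gcd
  with \<open>q\<close> is taken at the end.\<close>

definition prime_power_cap :: "nat \<Rightarrow> nat \<Rightarrow> nat" where
  "prime_power_cap q N = (\<Prod>p\<in>prime_factors q. p ^ max_exponent p N)"

lemma power_le_imp_exp_le:
  fixes p :: nat
  assumes "p ^ j \<le> N" "2 \<le> p"
  shows "j \<le> N"
proof -
  have "j < p ^ j"
    using assms(2) by (intro power_gt_expt) simp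
  with assms(1) show ?thesis by simp
qed

lemma max_exponent_power_le:
  assumes "2 \<le> p" "0 < N"
  shows "p ^ max_exponent p N \<le> N"
  unfolding max_exponent_def
  by (rule GreatestI_nat[of _ 0 N]) (use assms power_le_imp_exp_le in auto)

lemma le_max_exponent:
  assumes "p ^ j \<le> N" "2 \<le> p"
  shows "j \<le> max_exponent p N"
  unfolding max_exponent_def
  by (rule Greatest_le_nat[of _ j N]) (use assms power_le_imp_exp_le in auto)

lemma max_exponent_mult:
  assumes "2 \<le> p" "0 < M" "0 < N"
  shows "max_exponent p M + max_exponent p N \<le> max_exponent p (M * N)"
proof (rule le_max_exponent)
  show "p ^ (max_exponent p M + max_exponent p N) \<le> M * N"
    unfolding power_add by (intro mult_le_mono max_exponent_power_le assms)
qed (fact assms(1))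

lemma ge_2_if_prime_factor:
  fixes p q :: nat
  shows "p \<in> prime_factors q \<Longrightarrow> 2 \<le> p"
  by (meson in_prime_factors_imp_prime prime_ge_2_nat)

text \<open>Floors of logarithms are superadditive, so caps multiply only up to
  divisibility.\<close>

lemma prime_power_cap_mult_dvd:
  assumes "0 < M" "0 < N"
  shows "prime_power_cap q M * prime_power_cap q N dvd prime_power_cap q (M * N)"
  unfolding prime_power_cap_def prod.distrib[symmetric] power_add[symmetric]
  by (intro prod_dvd_prod le_imp_power_dvd max_exponent_mult assms) (rule ge_2_if_prime_factor)

lemma prime_power_cap_1: "prime_power_cap q 1 = 1"
  unfolding prime_power_cap_def
proof (rule prod.neutral, rule ballI)
  fix p assume "p \<in> prime_factors q"
  then have "2 \<le> p"
    by (rule ge_2_if_prime_factor)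
  then have "p ^ max_exponent p 1 \<le> 1" "0 < p ^ max_exponent p 1"
    using max_exponent_power_le[of p 1] by simp_all
  then show "p ^ max_exponent p 1 = 1" by linarith
qed

lemma prime_power_cap_pos: "0 < prime_power_cap q N"
  unfolding prime_power_cap_def by (intro prod_pos) (auto dest: ge_2_if_prime_factor)

lemma omega_eq_card:
  assumes "q > 0"
  shows "omega q = card (prime_factors q)"
  using assms by (simp add: omega_def prime_factors_dvd)

lemma prime_power_cap_le:
  assumes "0 < q" "0 < N"
  shows "prime_power_cap q N \<le> N ^ omega q"
proof -
  have "prime_power_cap q N \<le> (\<Prod>p\<in>prime_factors q. N)"
    unfolding prime_power_cap_def
    by (intro prod_mono) (use max_exponent_power_le[OF ge_2_if_prime_factor assms(2)] in auto)
  then show ?thesis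
    by (simp add: omega_eq_card[OF assms(1)])
qed

lemma multiplicity_prime_power_cap:
  assumes "prime p" "p dvd q" "q > 0"
  shows "multiplicity p (prime_power_cap q N) = max_exponent p N"
  unfolding prime_power_cap_def
  using assms by (subst multiplicity_prod_prime_powers) (auto simp: prime_factors_dvd)

text \<open>Localises a failure of annihilation at one prime, where
  \<open>kloosterman_local_bound\<close> can act.\<close>

lemma multiplicity_less_if_not_dvd_prime_power_cap:
  assumes "q > 0" "D > 0" "\<not> q dvd D * prime_power_cap q N"
  obtains p where "prime p" "p dvd q" "multiplicity p D + max_exponent p N < multiplicity p q"
proof -
  obtain p where p: "prime p" "\<not> multiplicity p q \<le> multiplicity p (D * prime_power_cap q N)"
    using multiplicity_le_imp_dvd[of q "D * prime_power_cap q N"] assms by blast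
  then have "p dvd q"
    by (metis le0 not_dvd_imp_multiplicity_0)
  moreover have "multiplicity p (D * prime_power_cap q N) = multiplicity p D + max_exponent p N"
    using assms(1,2) p(1) prime_power_cap_pos[of q N] multiplicity_prime_power_cap[OF p(1) \<open>p dvd q\<close>]
    by (simp add: prime_elem_multiplicity_mult_distrib)
  ultimately show ?thesis
    using p that by simp
qed

text \<open>Ensures that large caps annihilate every frequency.\<close>

lemma dvd_prime_power_cap:
  assumes "0 < q" "q \<le> N"
  shows "q dvd prime_power_cap q N"
proof (rule ccontr)
  assume "\<not> q dvd prime_power_cap q N"
  then have "\<not> q dvd 1 * prime_power_cap q N" by simp
  then obtain p where p: "prime p" "p dvd q" "multiplicity p 1 + max_exponent p N < multiplicity p q"
    using multiplicity_less_if_not_dvd_prime_power_cap[OF assms(1) zero_less_one] by blast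
  have "p ^ multiplicity p q \<le> q"
    using assms(1) by (intro dvd_imp_le multiplicity_dvd)
  then have "multiplicity p q \<le> max_exponent p N"
    using assms(2) p(1) by (intro le_max_exponent) (auto simp: prime_ge_2_nat)
  with p(3) show False by simp
qed

text \<open>
  The exponent \<open>51 = 3 \<cdot> 17\<close> comes from \<open>kloosterman_local_bound\<close>: \<open>p\<^sup>j > 2\<^bsup>51 r\<^esup>\<close> forces \<open>p\<^sup>i > 2\<^bsup>17 r\<^esup>\<close>, and
  \<open>24 \<cdot> 2\<^bsup>-17 r\<^esup> \<le> 8\<^bsup>-4 r\<^esup>\<close>.
\<close>

lemma kloosterman_bound:
  assumes "q > 0" "0 < r"
    and nd: "\<not> (int q dvd u * int (prime_power_cap q (2 ^ (51 * r))) \<and> int q dvd v * int (prime_power_cap q (2 ^ (51 * r))))"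
  shows "norm (kloosterman q u v) \<le> (1 / 8) ^ r * card (hyperbola q)"
proof -
  define D where "D = nat (gcd u v)"
  have D: "int D = gcd u v"
    by (simp add: D_def)
  have "D > 0"
    using nd by (auto intro!: Nat.gr0I simp: D_def)
  moreover have "\<not> q dvd D * prime_power_cap q (2 ^ (51 * r))"
  proof
    assume "q dvd D * prime_power_cap q (2 ^ (51 * r))"
    then have *: "int q dvd gcd u v * int (prime_power_cap q (2 ^ (51 * r)))"
      by (simp only: D[symmetric] of_nat_mult[symmetric] int_dvd_int_iff)
    have "int q dvd u * int (prime_power_cap q (2 ^ (51 * r)))" "int q dvd v * int (prime_power_cap q (2 ^ (51 * r)))"
      by (rule dvd_trans[OF * mult_dvd_mono], simp_all)+
    with nd show False by blast
  qed
  ultimately obtain p where p: "prime p" "p dvd q"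
      "multiplicity p D + max_exponent p (2 ^ (51 * r)) < multiplicity p q"
    using multiplicity_less_if_not_dvd_prime_power_cap[OF assms(1)] by blast
  define k where "k = multiplicity p q"
  \<comment> \<open>\<open>p ^ e\<close> is the exact power of \<open>p\<close> in
    \<open>gcd u v\<close>, so \<open>j = k - e\<close> exceeds the truncation exponent.\<close>
  define e where "e = multiplicity p D"
  define j where "j = k - e"
  have ej: "k - j = e" "j \<le> k" "max_exponent p (2 ^ (51 * r)) < j"
    using p(3) by (auto simp: j_def k_def e_def)
  have p2: "2 \<le> p"
    using p(1) by (rule prime_ge_2_nat)
  obtain q' where q': "q = p ^ k * q'" "\<not> p dvd q'"
    using multiplicity_decompose'[of q p] assms(1) p2 unfolding k_def by auto
  have pe: "int (p ^ e) dvd gcd u v"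
    unfolding D[symmetric] int_dvd_int_iff e_def by (rule multiplicity_dvd)
  then have "int p ^ e dvd u" "int p ^ e dvd v"
    by (auto dest: dvd_trans)
  then obtain u' v' where uv: "u = int p ^ e * u'" "v = int p ^ e * v'"
    by (auto elim!: dvdE)
  have "\<not> (int p dvd u' \<and> int p dvd v')"
  proof
    assume "int p dvd u' \<and> int p dvd v'"
    then have "int p ^ e * int p dvd u" "int p ^ e * int p dvd v"
      unfolding uv by (auto intro: mult_dvd_mono)
    then have "int (p ^ Suc e) dvd int D"
      unfolding D by (simp add: mult.commute)
    then have "p ^ Suc e dvd D"
      by (simp only: int_dvd_int_iff)
    then have "Suc e \<le> multiplicity p D"
      using \<open>D > 0\<close> p2 by (intro multiplicity_geI) auto
    then show False by (simp add: e_def)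
  qed
  \<comment> \<open>This is \<open>j / 3\<close> rounded up, the largest value that
    \<open>3 * i < j + 3\<close> permits.\<close>
  define i where "i = (j + 2) div 3"
  have i: "0 < i" "i \<le> j" "3 * i < j + 3" "j \<le> 3 * i"
    using ej(3) by (auto simp: i_def)
  define K where "K = norm (kloosterman q u v)"
  define N where "N = real (card (hyperbola q))"
  \<comment> \<open>At least one of \<open>u'\<close>, \<open>v'\<close> is prime to
    \<open>p\<close>; the symmetry of the sum lets it come first.\<close>
  have main: "K ^ 4 * real (p ^ i) \<le> 24 * N ^ 4"
  proof (cases "int p dvd u'")
    case False
    then show ?thesis
      unfolding K_def N_def
      by (intro kloosterman_local_bound[where j = j and u' = u' and v' = v', OF p(1) q' i(1,2) ej(2) i(3)])
        (simp_all add: ej uv)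
  next
    case True
    with \<open>\<not> (int p dvd u' \<and> int p dvd v')\<close> have "\<not> int p dvd v'" by blast
    then show ?thesis
      unfolding K_def N_def kloosterman_swap[of q u v]
      by (intro kloosterman_local_bound[where j = j and u' = v' and v' = u', OF p(1) q' i(1,2) ej(2) i(3)])
        (simp_all add: ej uv)
  qed
  have "2 ^ (51 * r) < p ^ j"
    using le_max_exponent[of p j "2 ^ (51 * r)"] p2 ej(3) by linarith
  also have "\<dots> \<le> p ^ (3 * i)"
    using p2 i(4) by (intro power_increasing) auto
  finally have "(2 ^ (17 * r)) ^ 3 < (p ^ i) ^ 3"
    by (simp add: mult.commute flip: power_mult)
  then have "2 ^ (17 * r) < p ^ i"
    by (rule power_less_imp_less_base) simp
  then have "real (2 ^ (17 * r)) \<le> real (p ^ i)"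
    by (simp only: of_nat_le_iff)
  then have "K ^ 4 * real (2 ^ (17 * r)) \<le> K ^ 4 * real (p ^ i)"
    by (intro mult_left_mono) (auto simp: K_def)
  also have "\<dots> \<le> 24 * N ^ 4"
    by (rule main)
  \<comment> \<open>Of \<open>2 ^ (17 * r)\<close>, the factor \<open>2 ^ (5 * r)\<close> absorbs 24
    because \<open>r > 0\<close>, and \<open>2 ^ (12 * r)\<close> is
    \<open>(8 ^ r) ^ 4\<close>.\<close>
  also have "\<dots> \<le> 2 ^ (5 * r) * N ^ 4"
  proof (rule mult_right_mono)
    have "(2::real) ^ 5 \<le> 2 ^ (5 * r)"
      using assms(2) by (intro power_increasing) auto
    then show "24 \<le> (2::real) ^ (5 * r)"
      by simp
  qed (simp add: N_def)
  finally have "2 ^ (5 * r) * (2 ^ (12 * r) * K ^ 4) \<le> 2 ^ (5 * r) * N ^ 4"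
    by (simp add: mult_ac flip: power_add)
  then have "2 ^ (12 * r) * K ^ 4 \<le> N ^ 4"
    by (simp only: mult_le_cancel_left_pos zero_less_power zero_less_numeral)
  moreover have "(2::real) ^ (12 * r) = (8 ^ r) ^ 4"
    using power_mult[of "2::real" 3 "r * 4"] by (simp add: mult.commute flip: power_mult)
  ultimately have "(8 ^ r * K) ^ 4 \<le> N ^ 4"
    by (simp add: power_mult_distrib)
  then have "8 ^ r * K \<le> N"
    by (rule power_le_imp_le_base[of _ 3, simplified]) (simp add: N_def)
  then show ?thesis
    unfolding K_def N_def by (simp add: field_simps power_one_over)
qed

section \<open>Spectral energy and the density increment\<close>

definition power_spectrum :: "nat \<Rightarrow> int set \<Rightarrow> int \<Rightarrow> real" where
  "power_spectrum q A \<xi> = (norm (\<Sum>a\<in>A. add_char q (\<xi> * a)))\<^sup>2"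

text \<open>
  By Parseval this is \<open>q\<^sup>2\<close> times the mean square density of \<open>A\<close> on the cosets of \<open>m \<int>/q\<int>\<close>; only
  its monotonicity in \<open>m\<close> and its range are needed.
\<close>

definition spectral_energy :: "nat \<Rightarrow> int set \<Rightarrow> int \<Rightarrow> real" where
  "spectral_energy q A m = (\<Sum>\<xi> | \<xi> \<in> {0..<int q} \<and> int q dvd \<xi> * m. power_spectrum q A \<xi>)"

lemma power_spectrum_nonneg [simp]: "0 \<le> power_spectrum q A \<xi>"
  by (simp add: power_spectrum_def)

lemma finite_freq: "finite {\<xi>. \<xi> \<in> {0..<int q} \<and> P \<xi>}"
  by (rule finite_subset[of _ "{0..<int q}"]) auto

text \<open>Fourier inversion for the autocorrelation of \<open>A\<close>, which counts
  representations of \<open>- s\<close> as a difference.\<close>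

lemma sum_power_spectrum_add_char:
  assumes "q > 0" "finite A"
  shows "(\<Sum>\<xi>\<in>{0..<int q}. power_spectrum q A \<xi> * add_char q (\<xi> * s)) =
    of_nat q * of_nat (card {z \<in> A \<times> A. int q dvd fst z - snd z + s})"
proof -
  have "(\<Sum>\<xi>\<in>{0..<int q}. power_spectrum q A \<xi> * add_char q (\<xi> * s)) =
      (\<Sum>\<xi>\<in>{0..<int q}. \<Sum>z\<in>A \<times> A. add_char q (\<xi> * (fst z - snd z + s)))"
  proof (intro sum.cong refl)
    fix \<xi>
    have "complex_of_real (power_spectrum q A \<xi>) = (\<Sum>z\<in>A \<times> A. add_char q (\<xi> * fst z) * cnj (add_char q (\<xi> * snd z)))"
      unfolding power_spectrum_def complex_norm_square cnj_sum sum_product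
      by (simp only: sum.cartesian_product' fst_conv snd_conv)
    then have "power_spectrum q A \<xi> * add_char q (\<xi> * s) =
        (\<Sum>z\<in>A \<times> A. add_char q (\<xi> * fst z) * cnj (add_char q (\<xi> * snd z)) * add_char q (\<xi> * s))"
      by (simp only: sum_distrib_right)
    also have "\<dots> = (\<Sum>z\<in>A \<times> A. add_char q (\<xi> * (fst z - snd z + s)))"
      by (simp only: distrib_left right_diff_distrib add_char_add add_char_diff)
    finally show "power_spectrum q A \<xi> * add_char q (\<xi> * s) = (\<Sum>z\<in>A \<times> A. add_char q (\<xi> * (fst z - snd z + s)))" .
  qed
  also have "\<dots> = (\<Sum>z\<in>A \<times> A. \<Sum>\<xi>\<in>{0..<int q}. add_char q (\<xi> * (fst z - snd z + s)))"
    by (rule sum.swap)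
  also have "\<dots> = (\<Sum>z\<in>A \<times> A. if int q dvd fst z - snd z + s then of_nat q else 0)"
    by (simp only: sum_add_char[OF assms(1)])
  also have "\<dots> = (\<Sum>z\<in>{z \<in> A \<times> A. int q dvd fst z - snd z + s}. of_nat q)"
    using assms(2) by (simp only: sum.inter_filter finite_cartesian_product)
  finally show ?thesis
    by simp
qed

lemma sum_power_spectrum:
  assumes "q > 0" "A \<subseteq> {0..<int q}"
  shows "(\<Sum>\<xi>\<in>{0..<int q}. power_spectrum q A \<xi>) = real q * card A"
proof -
  have fin: "finite A"
    using assms(2) finite_subset by blast
  have "{z \<in> A \<times> A. int q dvd fst z - snd z + 0} = (\<lambda>a. (a, a)) ` A"
  proof (intro equalityI subsetI)
    fix z assume z: "z \<in> {z \<in> A \<times> A. int q dvd fst z - snd z + 0}"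
    then have "fst z mod int q = snd z mod int q"
      by (simp add: mod_eq_dvd_iff)
    moreover have "fst z \<in> {0..<int q}" "snd z \<in> {0..<int q}"
      using z assms(2) by auto
    ultimately have "fst z = snd z" by simp
    then show "z \<in> (\<lambda>a. (a, a)) ` A"
      using z by (cases z) auto
  qed auto
  then have "card {z \<in> A \<times> A. int q dvd fst z - snd z + 0} = card A"
    using card_image[of "\<lambda>a. (a, a)" A] by (simp add: inj_on_def)
  then have "complex_of_real (\<Sum>\<xi>\<in>{0..<int q}. power_spectrum q A \<xi>) = complex_of_real (real q * card A)"
    using sum_power_spectrum_add_char[OF assms(1) fin, of 0] by simp
  then show ?thesis
    by (simp only: of_real_eq_iff)
qed

lemma spectral_energy_le:
  assumes "q > 0" "A \<subseteq> {0..<int q}"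
  shows "spectral_energy q A m \<le> real q * card A"
  unfolding spectral_energy_def sum_power_spectrum[OF assms, symmetric] by (rule sum_mono2) auto

text \<open>The zero frequency alone gives this. With \<open>spectral_energy_le\<close> it confines
  all energies of \<open>A\<close> to an interval of ratio \<open>q / card A\<close>.\<close>

lemma spectral_energy_ge:
  assumes "q > 0"
  shows "(real (card A))\<^sup>2 \<le> spectral_energy q A m"
proof -
  have "(real (card A))\<^sup>2 = (\<Sum>\<xi>\<in>{0}. power_spectrum q A \<xi>)"
    by (simp add: power_spectrum_def)
  also have "\<dots> \<le> spectral_energy q A m"
    unfolding spectral_energy_def using assms by (intro sum_mono2 finite_freq) auto
  finally show ?thesis .
qed

lemma spectral_energy_mono:
  assumes "m dvd m'"
  shows "spectral_energy q A m \<le> spectral_energy q A m'"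
  unfolding spectral_energy_def using assms
  by (intro sum_mono2 finite_freq) (auto intro: dvd_trans[OF _ mult_dvd_mono])

section \<open>Solutions on the hyperbola from slow spectral growth\<close>

lemma sum_kloosterman_eq_0:
  assumes "q > 0" "finite A" "finite B"
    and no_sol: "\<And>t s a a' b b'. \<lbrakk>(t, s) \<in> hyperbola q; a \<in> A; a' \<in> A; b \<in> B; b' \<in> B;
      int q dvd a - a' + e1 * t\<rbrakk> \<Longrightarrow> \<not> int q dvd b - b' + e2 * s"
  shows "(\<Sum>z\<in>{0..<int q} \<times> {0..<int q}.
      of_real (power_spectrum q A (fst z) * power_spectrum q B (snd z)) * kloosterman q (fst z * e1) (snd z * e2)) = 0"
proof -
  have "(\<Sum>z\<in>{0..<int q} \<times> {0..<int q}.
      of_real (power_spectrum q A (fst z) * power_spectrum q B (snd z)) * kloosterman q (fst z * e1) (snd z * e2)) =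
    (\<Sum>z\<in>{0..<int q} \<times> {0..<int q}. \<Sum>h\<in>hyperbola q.
      (power_spectrum q A (fst z) * add_char q (fst z * (e1 * fst h))) * (power_spectrum q B (snd z) * add_char q (snd z * (e2 * snd h))))"
    unfolding kloosterman_def sum_distrib_left of_real_mult add_char_add by (simp only: mult_ac)
  \<comment> \<open>After the exchange, a point \<open>(t, s)\<close> contributes
    \<open>q\<^sup>2\<close> times the number of ways to write \<open>- e1 * t\<close> as a
    difference in \<open>A\<close> and \<open>- e2 * s\<close> as one in \<open>B\<close>.\<close>
  also have "\<dots> = (\<Sum>h\<in>hyperbola q. \<Sum>z\<in>{0..<int q} \<times> {0..<int q}.
      (power_spectrum q A (fst z) * add_char q (fst z * (e1 * fst h))) * (power_spectrum q B (snd z) * add_char q (snd z * (e2 * snd h))))"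
    by (rule sum.swap)
  also have "\<dots> = (\<Sum>h\<in>hyperbola q. (\<Sum>\<xi>\<in>{0..<int q}. power_spectrum q A \<xi> * add_char q (\<xi> * (e1 * fst h)))
      * (\<Sum>\<eta>\<in>{0..<int q}. power_spectrum q B \<eta> * add_char q (\<eta> * (e2 * snd h))))"
    unfolding sum_product by (simp only: sum.cartesian_product' fst_conv snd_conv)
  also have "\<dots> = (\<Sum>h\<in>hyperbola q. 0)"
  proof (rule sum.cong[OF refl])
    fix h assume h: "h \<in> hyperbola q"
    have "{z \<in> A \<times> A. int q dvd fst z - snd z + e1 * fst h} = {} \<or>
        {z \<in> B \<times> B. int q dvd fst z - snd z + e2 * snd h} = {}"
      using no_sol[of "fst h" "snd h"] h by fastforce
    then show "(\<Sum>\<xi>\<in>{0..<int q}. power_spectrum q A \<xi> * add_char q (\<xi> * (e1 * fst h)))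
      * (\<Sum>\<eta>\<in>{0..<int q}. power_spectrum q B \<eta> * add_char q (\<eta> * (e2 * snd h))) = 0"
      unfolding sum_power_spectrum_add_char[OF assms(1,2)] sum_power_spectrum_add_char[OF assms(1,3)]
      by (elim disjE) (simp_all only: card.empty of_nat_0 mult_zero_left mult_zero_right)
  qed
  finally show ?thesis
    by simp
qed

text \<open>Without a solution the weighted Kloosterman sum vanishes. Yet the frequencies in
  \<open>Z 0\<close>, killed by \<open>e1\<close> and \<open>e2\<close>, contribute exactly
  \<open>N * G 0\<close>, and the shells \<open>Z (Suc r) - Z r\<close> together at most half of
  that, since the decay \<open>(1 / 8) ^ r\<close> beats the growth
  \<open>(5 / 4) ^ r\<close>.\<close>

lemma hyperbola_solution:
  assumes "q > 0" "A \<subseteq> {0..<int q}" "B \<subseteq> {0..<int q}" "A \<noteq> {}" "B \<noteq> {}"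
    and growth: "\<And>r. spectral_energy q A (e1 * int (prime_power_cap q (2 ^ (51 * r)))) * spectral_energy q B (e2 * int (prime_power_cap q (2 ^ (51 * r))))
      \<le> (5 / 4) ^ r * (spectral_energy q A e1 * spectral_energy q B e2)"
  shows "\<exists>t s a a' b b'. (t, s) \<in> hyperbola q \<and> a \<in> A \<and> a' \<in> A \<and> b \<in> B \<and> b' \<in> B \<and>
    int q dvd a - a' + e1 * t \<and> int q dvd b - b' + e2 * s"
proof (rule ccontr)
  assume contra: "\<not> ?thesis"
  have no_sol: "\<not> int q dvd b - b' + e2 * s"
    if "(t, s) \<in> hyperbola q" "a \<in> A" "a' \<in> A" "b \<in> B" "b' \<in> B" "int q dvd a - a' + e1 * t"
    for t s a a' b b'
    using that contra by blast
  have fin: "finite A" "finite B"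
    using assms(2,3) finite_subset by blast+
  define R where "R r = int (prime_power_cap q (2 ^ (51 * r)))" for r
  define N where "N = real (card (hyperbola q))"
  define w where "w z = power_spectrum q A (fst z) * power_spectrum q B (snd z)" for z
  define F where "F z = w z * norm (kloosterman q (fst z * e1) (snd z * e2))" for z
  define box where "box = {0..<int q} \<times> {0..<int q}"
  define Z where "Z r = {z \<in> box. int q dvd fst z * e1 * R r \<and> int q dvd snd z * e2 * R r}" for r
  define G where "G r = spectral_energy q A (e1 * R r) * spectral_energy q B (e2 * R r)" for r
  have R0: "R 0 = 1"
    by (simp add: R_def prime_power_cap_1[simplified])
  have w0: "0 \<le> w z" for z
    by (simp add: w_def)
  have N0: "N > 0"
    using card_hyperbola_pos[OF assms(1)] by (simp add: N_def)
  have finZ: "finite (Z r)" for r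
    by (simp add: Z_def box_def)
  have FN: "F z \<le> w z * N" for z
    unfolding F_def N_def by (intro mult_left_mono norm_kloosterman_le w0)
  have sumZ: "sum w (Z r) = G r" for r
  proof -
    have "Z r = {\<xi>. \<xi> \<in> {0..<int q} \<and> int q dvd \<xi> * (e1 * R r)} \<times> {\<xi>. \<xi> \<in> {0..<int q} \<and> int q dvd \<xi> * (e2 * R r)}"
      by (auto simp: Z_def box_def mult.assoc)
    then show ?thesis
      unfolding G_def spectral_energy_def sum_product w_def
      by (simp only: sum.cartesian_product' fst_conv snd_conv)
  qed
  have growth': "G r \<le> (5 / 4) ^ r * G 0" for r
    using growth[of r] by (simp add: G_def R_def[symmetric] R0)
  have G0: "G 0 > 0"
  proof -
    have "0 < (real (card A))\<^sup>2" "0 < (real (card B))\<^sup>2"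
      using fin assms(4,5) by auto
    then have "0 < spectral_energy q A (e1 * R 0)" "0 < spectral_energy q B (e2 * R 0)"
      using spectral_energy_ge[OF assms(1)] less_le_trans by blast+
    then show ?thesis
      by (simp add: G_def)
  qed
  have Zmono: "Z r \<subseteq> Z (Suc r)" for r
  proof -
    have "prime_power_cap q (2 ^ (51 * r)) * prime_power_cap q (2 ^ 51) dvd prime_power_cap q (2 ^ (51 * r) * 2 ^ 51)"
      by (rule prime_power_cap_mult_dvd) simp_all
    then have "prime_power_cap q (2 ^ (51 * r)) dvd prime_power_cap q (2 ^ (51 * Suc r))"
      by (metis dvd_mult_left mult_Suc_right power_add mult.commute)
    then have "R r dvd R (Suc r)"
      by (simp only: R_def int_dvd_int_iff)
    then show ?thesis
      unfolding Z_def by (auto intro: dvd_trans[OF _ mult_dvd_mono])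
  qed
  have Z0: "Z 0 \<subseteq> Z r" for r
    by (induction r) (use Zmono in auto)
  \<comment> \<open>Partial sums of \<open>1 / 4\<close> and \<open>5 / 4 * (1 / 6) ^ r\<close> for
    \<open>r \<ge> 1\<close>; the limit is \<open>1 / 4 + 1 / 4\<close>.\<close>
  have bound: "sum F (Z (Suc m) - Z 0) \<le> (1 / 2 - 1 / 4 * (1 / 6) ^ m) * (N * G 0)" for m
  proof (induction m)
    case 0
    \<comment> \<open>The first shell has no Kloosterman decay, but its mass
      \<open>G 1 - G 0\<close> is at most \<open>G 0 / 4\<close>.\<close>
    have "sum F (Z (Suc 0) - Z 0) \<le> (\<Sum>z\<in>Z (Suc 0) - Z 0. w z * N)"
      by (intro sum_mono FN)
    also have "\<dots> = (G (Suc 0) - G 0) * N"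
      by (simp only: sum_distrib_right[symmetric] sum_diff[OF finZ Z0] sumZ)
    also have "\<dots> \<le> (1 / 4 * G 0) * N"
      using growth'[of 1] N0 by (intro mult_right_mono) auto
    also have "\<dots> = (1 / 2 - 1 / 4 * (1 / 6) ^ 0) * (N * G 0)"
      by simp
    finally show ?case .
  next
    case (Suc m)
    have "Z (Suc (Suc m)) - Z 0 = (Z (Suc m) - Z 0) \<union> (Z (Suc (Suc m)) - Z (Suc m))"
      using Zmono Z0 by blast
    moreover have disj: "(Z (Suc m) - Z 0) \<inter> (Z (Suc (Suc m)) - Z (Suc m)) = {}"
      by blast
    ultimately have "sum F (Z (Suc (Suc m)) - Z 0) = sum F (Z (Suc m) - Z 0) + sum F (Z (Suc (Suc m)) - Z (Suc m))"
      using sum.union_disjoint[of "Z (Suc m) - Z 0" "Z (Suc (Suc m)) - Z (Suc m)" F, OF finite_Diff[OF finZ] finite_Diff[OF finZ]]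
      using disj by (simp only:)
    moreover have "sum F (Z (Suc (Suc m)) - Z (Suc m)) \<le> 5 / 4 * (1 / 6) ^ Suc m * (N * G 0)"
    proof -
      have "F z \<le> w z * ((1 / 8) ^ Suc m * N)" if "z \<in> Z (Suc (Suc m)) - Z (Suc m)" for z
      proof -
        have "\<not> (int q dvd fst z * e1 * R (Suc m) \<and> int q dvd snd z * e2 * R (Suc m))"
          using that by (auto simp: Z_def)
        then show ?thesis
          unfolding F_def N_def R_def by (intro mult_left_mono kloosterman_bound assms(1) w0) simp_all
      qed
      then have "sum F (Z (Suc (Suc m)) - Z (Suc m)) \<le>
          (\<Sum>z\<in>Z (Suc (Suc m)) - Z (Suc m). w z * ((1 / 8) ^ Suc m * N))"
        by (rule sum_mono)
      also have "\<dots> \<le> (\<Sum>z\<in>Z (Suc (Suc m)). w z * ((1 / 8) ^ Suc m * N))"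
        using N0 w0 by (intro sum_mono2 finZ) auto
      also have "\<dots> = G (Suc (Suc m)) * ((1 / 8) ^ Suc m * N)"
        by (simp only: sum_distrib_right[symmetric] sumZ)
      also have "\<dots> \<le> (5 / 4) ^ Suc (Suc m) * G 0 * ((1 / 8) ^ Suc m * N)"
        using N0 by (intro mult_right_mono growth') auto
      also have "\<dots> = 5 / 4 * (5 / 32) ^ Suc m * (N * G 0)"
      proof -
        have "(5 / 32 :: real) ^ Suc m = (5 / 4) ^ Suc m * (1 / 8) ^ Suc m"
          by (simp only: power_mult_distrib[symmetric]) simp
        then show ?thesis
          by (simp only: power_Suc[of "5 / 4 :: real" "Suc m"] mult_ac)
      qed
      \<comment> \<open>\<open>5 / 32\<close>, growth times decay, is rounded up to
        \<open>1 / 6\<close>.\<close>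
      also have "\<dots> \<le> 5 / 4 * (1 / 6) ^ Suc m * (N * G 0)"
        using N0 G0 by (intro mult_right_mono mult_left_mono power_mono) auto
      finally show ?thesis .
    qed
    ultimately have "sum F (Z (Suc (Suc m)) - Z 0) \<le>
        (1 / 2 - 1 / 4 * (1 / 6) ^ m) * (N * G 0) + 5 / 4 * (1 / 6) ^ Suc m * (N * G 0)"
      using Suc.IH by linarith
    also have "\<dots> = (1 / 2 - 1 / 4 * (1 / 6) ^ Suc m) * (N * G 0)"
      by (simp add: field_simps)
    finally show ?case .
  qed
  \<comment> \<open>\<open>q < 2 ^ q\<close> makes level \<open>Suc q\<close> exhaust all
    frequencies.\<close>
  have Zbox: "Z (Suc q) = box"
  proof -
    have "q < 2 ^ q"
      by (rule less_exp)
    also have "\<dots> \<le> 2 ^ (51 * Suc q)"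
      by (rule power_increasing) auto
    finally have "q dvd prime_power_cap q (2 ^ (51 * Suc q))"
      using assms(1) by (intro dvd_prime_power_cap) auto
    then have "int q dvd R (Suc q)"
      by (simp only: R_def int_dvd_int_iff)
    then show ?thesis
      by (auto simp: Z_def)
  qed
  have "0 = (\<Sum>z\<in>box. of_real (w z) * kloosterman q (fst z * e1) (snd z * e2))"
    unfolding w_def box_def by (rule sum_kloosterman_eq_0[symmetric, OF assms(1) fin no_sol])
  also have "\<dots> = (\<Sum>z\<in>box - Z 0. of_real (w z) * kloosterman q (fst z * e1) (snd z * e2))
      + (\<Sum>z\<in>Z 0. of_real (w z) * kloosterman q (fst z * e1) (snd z * e2))"
    by (rule sum.subset_diff) (auto simp: box_def Z_def)
  also have "(\<Sum>z\<in>Z 0. of_real (w z) * kloosterman q (fst z * e1) (snd z * e2)) = (\<Sum>z\<in>Z 0. of_real (w z * N))"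
  proof (rule sum.cong[OF refl])
    fix z assume "z \<in> Z 0"
    then have "kloosterman q (fst z * e1) (snd z * e2) = kloosterman q 0 0"
      by (intro kloosterman_cong assms(1)) (auto simp: Z_def R0 cong_0_iff)
    then show "of_real (w z) * kloosterman q (fst z * e1) (snd z * e2) = of_real (w z * N)"
      by (simp add: kloosterman_def N_def)
  qed
  also have "\<dots> = of_real (G 0 * N)"
    by (simp only: of_real_sum[symmetric] sum_distrib_right[symmetric] sumZ)
  finally have "complex_of_real (G 0 * N) = - (\<Sum>z\<in>box - Z 0. of_real (w z) * kloosterman q (fst z * e1) (snd z * e2))"
    by (simp add: eq_neg_iff_add_eq_0 add.commute)
  then have "norm (complex_of_real (G 0 * N)) \<le> (\<Sum>z\<in>box - Z 0. norm (of_real (w z) * kloosterman q (fst z * e1) (snd z * e2)))"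
    by (simp only: norm_minus_cancel norm_sum)
  also have "\<dots> = sum F (Z (Suc q) - Z 0)"
    unfolding Zbox F_def by (intro sum.cong refl) (simp add: norm_mult w0)
  also have "\<dots> \<le> (1 / 2 - 1 / 4 * (1 / 6) ^ q) * (N * G 0)"
    by (rule bound)
  also have "\<dots> \<le> 1 / 2 * (N * G 0)"
    using N0 G0 by (intro mult_right_mono) auto
  also have "\<dots> < norm (complex_of_real (G 0 * N))"
    using N0 G0 by (simp add: norm_mult)
  finally show False by simp
qed

text \<open>Jumping from a bad index \<open>i\<close> to \<open>i + r\<close> multiplies \<open>f\<close> by \<open>\<rho>\<^sup>r\<close> and skips at most \<open>r\<close> bad indices.\<close>

lemma card_jumps_le:
  fixes f :: "nat \<Rightarrow> real"
  assumes "mono f" "0 < f 0" "1 < \<rho>" "\<And>n. f n \<le> \<rho> ^ L * f 0"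
  shows "card {i. i < n \<and> (\<exists>r. \<rho> ^ r * f i < f (i + r))} \<le> L"
proof -
  define J where "J i = {l. i \<le> l \<and> l < n \<and> (\<exists>r. \<rho> ^ r * f l < f (l + r))}" for i
  have finJ: "finite (J i)" for i
    by (rule finite_subset[of _ "{..<n}"]) (auto simp: J_def)
  have f0: "0 < f i" for i
    using assms(1,2) by (metis le0 less_le_trans monoD)
  \<comment> \<open>Walk upwards from \<open>i\<close>, by single steps at good indices and by whole
    jumps at bad ones; \<open>m\<close> is where the walk leaves the range below
    \<open>n\<close>.\<close>
  have "\<exists>m. \<rho> ^ card (J i) * f i \<le> f m" for i
  proof (induction "n - i" arbitrary: i rule: less_induct)
    case less
    show ?case
    proof (cases "i < n")
      case False
      then have "J i = {}"
        by (auto simp: J_def)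
      then show ?thesis
        by (intro exI[of _ i]) simp
    next
      case True
      obtain r where r: "0 < r" "\<rho> ^ card (J i) * f i \<le> \<rho> ^ card (J (i + r)) * f (i + r)"
      proof (cases "i \<in> J i")
        case False
        then have "J i \<subseteq> J (i + 1)"
          by (auto simp: J_def) (metis Suc_leI le_neq_implies_less)
        then have "card (J i) \<le> card (J (i + 1))"
          by (intro card_mono finJ)
        then have "\<rho> ^ card (J i) * f i \<le> \<rho> ^ card (J (i + 1)) * f (i + 1)"
          using assms(3) f0[of i] monoD[OF assms(1), of i "i + 1"] by (intro mult_mono power_increasing) auto
        then show ?thesis
          by (intro that[of 1]) auto
      next
        case True
        then obtain r where r: "\<rho> ^ r * f i < f (i + r)"
          by (auto simp: J_def)
        have "J i \<subseteq> {i..<i + r} \<union> J (i + r)"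
          by (auto simp: J_def)
        then have "card (J i) \<le> card ({i..<i + r} \<union> J (i + r))"
          by (intro card_mono) (auto simp: finJ)
        also have "\<dots> \<le> r + card (J (i + r))"
          using card_Un_le[of "{i..<i + r}" "J (i + r)"] by simp
        finally have "\<rho> ^ card (J i) * f i \<le> \<rho> ^ (r + card (J (i + r))) * f i"
          using assms(3) f0[of i] by (intro mult_right_mono power_increasing) auto
        also have "\<dots> = \<rho> ^ card (J (i + r)) * (\<rho> ^ r * f i)"
          by (simp add: power_add)
        also have "\<dots> \<le> \<rho> ^ card (J (i + r)) * f (i + r)"
          using r assms(3) by (intro mult_left_mono) auto
        finally show ?thesis
          using r by (intro that[of r]) (auto intro: Nat.gr0I)
      qed
      moreover have "n - (i + r) < n - i"
        using True r(1) by simp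
      then obtain m where "\<rho> ^ card (J (i + r)) * f (i + r) \<le> f m"
        using less by blast
      ultimately show ?thesis
        using order_trans by blast
    qed
  qed
  then obtain m where "\<rho> ^ card (J 0) * f 0 \<le> f m" by blast
  then have "\<rho> ^ card (J 0) * f 0 \<le> \<rho> ^ L * f 0"
    using assms(4) order_trans by blast
  then have "\<rho> ^ card (J 0) \<le> \<rho> ^ L"
    using assms(2) by simp
  then have "card (J 0) \<le> L"
    using assms(3) by simp
  then show ?thesis
    by (simp add: J_def)
qed

text \<open>Each function has at most \<open>L\<close> bad indices up to \<open>3 * L\<close>, while
  \<open>{L..3 * L}\<close> has \<open>2 * L + 1\<close> elements. \<open>h\<close> is read
  backwards because enlarging the factor on the \<open>A\<close> side shrinks the one on the
  \<open>B\<close> side.\<close>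

lemma common_good_index:
  fixes f h :: "nat \<Rightarrow> real"
  assumes "mono f" "0 < f 0" "\<And>n. f n \<le> \<rho> ^ L * f 0"
    and "mono h" "0 < h 0" "\<And>n. h n \<le> \<rho> ^ L * h 0" and "1 < \<rho>"
  obtains i where "L \<le> i" "i \<le> 3 * L" "\<And>r. f (i + r) \<le> \<rho> ^ r * f i"
    "\<And>r. h (3 * L - i + r) \<le> \<rho> ^ r * h (3 * L - i)"
proof -
  define Jf where "Jf = {i. i < Suc (3 * L) \<and> (\<exists>r. \<rho> ^ r * f i < f (i + r))}"
  define Jh where "Jh = {i. i < Suc (3 * L) \<and> (\<exists>r. \<rho> ^ r * h i < h (i + r))}"
  have "card Jf \<le> L" "card Jh \<le> L"
    unfolding Jf_def Jh_def by (rule card_jumps_le[OF assms(1,2,7,3)], rule card_jumps_le[OF assms(4,5,7,6)])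
  moreover have "finite Jh" "finite Jf"
    by (rule finite_subset[of _ "{..<Suc (3 * L)}"], auto simp: Jf_def Jh_def)+
  ultimately have "card (Jf \<union> (\<lambda>i. 3 * L - i) ` Jh) \<le> 2 * L" "finite (Jf \<union> (\<lambda>i. 3 * L - i) ` Jh)"
    using card_Un_le[of Jf "(\<lambda>i. 3 * L - i) ` Jh"] card_image_le[of Jh "\<lambda>i. 3 * L - i"] by auto
  then have "\<not> {L..3 * L} \<subseteq> Jf \<union> (\<lambda>i. 3 * L - i) ` Jh"
    using card_mono[of "Jf \<union> (\<lambda>i. 3 * L - i) ` Jh" "{L..3 * L}"] by auto
  then obtain i where i: "L \<le> i" "i \<le> 3 * L" "i \<notin> Jf" "i \<notin> (\<lambda>i. 3 * L - i) ` Jh"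
    unfolding subset_iff Un_iff atLeastAtMost_iff by blast
  have "3 * L - i \<notin> Jh"
  proof
    assume "3 * L - i \<in> Jh"
    then have "3 * L - (3 * L - i) \<in> (\<lambda>i. 3 * L - i) ` Jh"
      by (rule imageI)
    with i show False by simp
  qed
  then have "h (3 * L - i + r) \<le> \<rho> ^ r * h (3 * L - i)" for r
    by (auto simp: Jh_def not_less)
  moreover have "f (i + r) \<le> \<rho> ^ r * f i" for r
    using i by (auto simp: Jf_def not_less)
  ultimately show ?thesis
    using that i by blast
qed

text \<open>Apply \<open>hyperbola_solution\<close> with \<open>e1 = R i\<close> and
  \<open>e2 = x * (R T div R i)\<close> at a common good index; as \<open>t * s\<close> is 1 modulo
  \<open>q\<close>, the product of the differences is \<open>R T * x\<close> whatever
  \<open>i\<close> is.\<close>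

lemma product_of_differences_smooth:
  fixes x :: int
  assumes "q > 0" "A \<subseteq> {0..<int q}" "B \<subseteq> {0..<int q}" "A \<noteq> {}" "B \<noteq> {}"
    and large: "real q \<le> (11 / 10) ^ L * card A" "real q \<le> (11 / 10) ^ L * card B"
  shows "\<exists>a\<in>A. \<exists>a'\<in>A. \<exists>b\<in>B. \<exists>b'\<in>B.
    int q dvd (a - a') * (b - b') - int (prime_power_cap q (2 ^ (51 * (3 * L)))) * x"
proof -
  define \<rho> :: real where "\<rho> = 11 / 10"
  define T where "T = 3 * L"
  define R where "R r = int (prime_power_cap q (2 ^ (51 * r)))" for r
  define f where "f i = spectral_energy q A (R i)" for i
  \<comment> \<open>The index is reversed so that \<open>h\<close> increases; truncated subtraction
    makes it constant beyond \<open>T\<close>.\<close>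
  define h where "h i = spectral_energy q B (x * (R T div R (T - i)))" for i
  have fin: "finite A" "finite B"
    using assms(2,3) finite_subset by blast+
  have R0: "R i \<noteq> 0" for i
    using prime_power_cap_pos[of q] by (simp add: R_def)
  have Rmult: "R i * R j dvd R (i + j)" for i j
    using prime_power_cap_mult_dvd[of "2 ^ (51 * i)" "2 ^ (51 * j)" q]
    by (simp only: R_def of_nat_mult[symmetric] int_dvd_int_iff power_add distrib_left) simp
  have Rmono: "R i dvd R j" if "i \<le> j" for i j
    using Rmult[of i "j - i"] that by (auto dest: dvd_mult_left)
  have Rdiv: "R T div R i * R r dvd R T div R (i - r)" if ri: "r \<le> i" and iT: "i \<le> T" for r i
  proof -
    obtain c where c: "R T = R i * c"
      using Rmono[OF iT] by blast
    obtain m where m: "R i = R (i - r) * R r * m"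
      using Rmult[of "i - r" r] ri by (auto elim: dvdE)
    have "R T div R i = c"
      using c R0 by simp
    moreover have "R T div R (i - r) = R r * m * c"
      using c m R0 by (simp add: mult.assoc)
    ultimately show ?thesis
      by simp
  qed
  have card_pos: "card A > 0" "card B > 0"
    using fin assms(4,5) by auto
  have top: "spectral_energy q S m \<le> \<rho> ^ L * spectral_energy q S m'"
    if "S \<subseteq> {0..<int q}" "real q \<le> \<rho> ^ L * card S" for S m m'
  proof -
    have "spectral_energy q S m \<le> real q * card S"
      by (rule spectral_energy_le[OF assms(1) that(1)])
    also have "\<dots> \<le> \<rho> ^ L * card S * card S"
      using that(2) by (intro mult_right_mono) auto
    also have "\<dots> = \<rho> ^ L * (real (card S))\<^sup>2"
      by (simp add: power2_eq_square)
    also have "\<dots> \<le> \<rho> ^ L * spectral_energy q S m'"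
      by (intro mult_left_mono spectral_energy_ge assms(1)) (simp add: \<rho>_def)
    finally show ?thesis .
  qed
  have pos: "0 < spectral_energy q S m" if "card S > 0" for S m
    using spectral_energy_ge[OF assms(1), of S m] that by (smt (verit) of_nat_0_less_iff zero_less_power)
  note topA = top[OF assms(2) large(1)[folded \<rho>_def]] and topB = top[OF assms(3) large(2)[folded \<rho>_def]]
  have "mono f"
    unfolding f_def by (intro monoI spectral_energy_mono Rmono)
  moreover have "mono h"
  proof (rule monoI)
    fix i j :: nat assume ij: "i \<le> j"
    have "T - i - (T - i - (T - j)) = T - j"
      using ij by simp
    moreover have "R T div R (T - i) * R (T - i - (T - j)) dvd R T div R (T - i - (T - i - (T - j)))"
      by (rule Rdiv) simp_all
    ultimately have "R T div R (T - i) dvd R T div R (T - j)"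
      by (simp only:) (rule dvd_mult_left)
    then show "h i \<le> h j"
      unfolding h_def by (intro spectral_energy_mono mult_dvd_mono dvd_refl)
  qed
  moreover have "0 < f 0" "0 < h 0"
    unfolding f_def h_def by (intro pos card_pos)+
  moreover have "f n \<le> \<rho> ^ L * f 0" "h n \<le> \<rho> ^ L * h 0" for n
    unfolding f_def h_def by (rule topA, rule topB)
  moreover have "1 < \<rho>"
    by (simp add: \<rho>_def)
  ultimately obtain i where i: "L \<le> i" "i \<le> T" "\<And>r. f (i + r) \<le> \<rho> ^ r * f i"
      "\<And>r. h (T - i + r) \<le> \<rho> ^ r * h (T - i)"
    unfolding T_def using common_good_index[of f \<rho> L h] by blast
  define e1 where "e1 = R i"
  define e2 where "e2 = x * (R T div R i)"
  have A: "spectral_energy q A (e1 * R r) \<le> \<rho> ^ r * spectral_energy q A e1" for r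
  proof -
    have "spectral_energy q A (e1 * R r) \<le> f (i + r)"
      unfolding e1_def f_def by (intro spectral_energy_mono Rmult)
    also have "\<dots> \<le> \<rho> ^ r * f i"
      by (rule i)
    finally show ?thesis
      by (simp add: f_def e1_def)
  qed
  \<comment> \<open>The reversed index reaches its end at \<open>r = i\<close>. Beyond it
    \<open>r > i \<ge> L\<close>, and the total range \<open>\<rho> ^ L\<close> of the energies is
    already below \<open>\<rho> ^ r\<close>.\<close>
  have B: "spectral_energy q B (e2 * R r) \<le> \<rho> ^ r * spectral_energy q B e2" for r
  proof (cases "r \<le> i")
    case True
    have "e2 * R r dvd x * (R T div R (i - r))"
      unfolding e2_def mult.assoc by (intro mult_dvd_mono dvd_refl Rdiv True i)
    moreover have "T - (T - i + r) = i - r"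
      using i(2) by simp
    ultimately have "spectral_energy q B (e2 * R r) \<le> h (T - i + r)"
      unfolding h_def by (simp add: spectral_energy_mono)
    also have "\<dots> \<le> \<rho> ^ r * h (T - i)"
      by (rule i)
    finally show ?thesis
      using i(2) by (simp add: h_def e2_def)
  next
    case False
    have "spectral_energy q B (e2 * R r) \<le> \<rho> ^ L * spectral_energy q B e2"
      by (rule topB)
    also have "\<dots> \<le> \<rho> ^ r * spectral_energy q B e2"
      using False i(1) pos[OF card_pos(2), of e2]
      by (intro mult_right_mono power_increasing) (auto simp: \<rho>_def)
    finally show ?thesis .
  qed
  have "spectral_energy q A (e1 * R r) * spectral_energy q B (e2 * R r) \<le> (5 / 4) ^ r * (spectral_energy q A e1 * spectral_energy q B e2)" for r
  proof -
    have nonneg: "0 \<le> spectral_energy q A e1" "0 \<le> spectral_energy q B e2" "0 \<le> spectral_energy q B (e2 * R r)"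
      using pos[OF card_pos(1)] pos[OF card_pos(2)] less_imp_le by blast+
    have "spectral_energy q A (e1 * R r) * spectral_energy q B (e2 * R r) \<le> (\<rho> ^ r * spectral_energy q A e1) * (\<rho> ^ r * spectral_energy q B e2)"
      using nonneg by (intro mult_mono A B) (auto simp: \<rho>_def)
    also have "\<dots> = (\<rho> * \<rho>) ^ r * (spectral_energy q A e1 * spectral_energy q B e2)"
      by (simp add: power_mult_distrib)
    \<comment> \<open>\<open>(11 / 10)\<^sup>2 = 121 / 100 \<le> 5 / 4\<close>.\<close>
    also have "\<dots> \<le> (5 / 4) ^ r * (spectral_energy q A e1 * spectral_energy q B e2)"
      using nonneg by (intro mult_right_mono power_mono) (auto simp: \<rho>_def)
    finally show ?thesis .
  qed
  then obtain t s a a' b b' where sol: "(t, s) \<in> hyperbola q" "a \<in> A" "a' \<in> A" "b \<in> B" "b' \<in> B"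
      "int q dvd a - a' + e1 * t" "int q dvd b - b' + e2 * s"
    using hyperbola_solution[OF assms(1-5), of e1 e2] unfolding R_def by blast
  have "[a - a' = - (e1 * t)] (mod int q)" "[b - b' = - (e2 * s)] (mod int q)"
    using sol(6,7) by (simp_all add: cong_iff_dvd_diff)
  then have "[(a - a') * (b - b') = (- (e1 * t)) * (- (e2 * s))] (mod int q)"
    by (rule cong_mult)
  also have "(- (e1 * t)) * (- (e2 * s)) = e1 * e2 * (t * s)"
    by simp
  also have "[e1 * e2 * (t * s) = e1 * e2 * 1] (mod int q)"
    using sol(1) by (intro cong_mult cong_refl) (auto simp: hyperbola_def)
  also have "e1 * e2 * 1 = R T * x"
    using Rmono[OF i(2)] by (simp add: e1_def e2_def)
  finally have "int q dvd (a - a') * (b - b') - R T * x"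
    by (simp add: cong_iff_dvd_diff)
  then show ?thesis
    using sol(2-5) unfolding R_def T_def by blast
qed

section \<open>The pigeonhole argument\<close>

text \<open>Pigeonhole for \<open>n\<close> translates of the power
  \<open>I \<rightarrow>\<^sub>E A\<close> by multiples of the vector \<open>c\<close>. Points of
  one translate stay distinct, so a collision involves two different multiples, and their difference
  is \<open>f\<close>.\<close>

lemma simultaneous_differences:
  fixes c :: "'i \<Rightarrow> int"
  assumes "q > 0" "A \<subseteq> {0..<int q}" "finite I" "q ^ card I < n * card A ^ card I"
  obtains f where "0 < f" "f < n" "\<And>k. k \<in> I \<Longrightarrow> \<exists>a\<in>A. \<exists>a'\<in>A. int q dvd a - a' - int f * c k"
proof -
  define g where "g z = (\<lambda>k\<in>I. (snd z k + int (fst z) * c k) mod int q)" for z :: "nat \<times> ('i \<Rightarrow> int)"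
  define S where "S = {..<n} \<times> (I \<rightarrow>\<^sub>E A)"
  have finA: "finite A"
    using assms(2) finite_subset by blast
  have "g ` S \<subseteq> I \<rightarrow>\<^sub>E {0..<int q}"
    using assms(1) by (auto simp: g_def)
  then have "card (g ` S) \<le> card (I \<rightarrow>\<^sub>E {0..<int q})"
    using assms(3) by (intro card_mono finite_PiE) auto
  also have "\<dots> = q ^ card I"
    using assms(3) by (simp add: card_PiE)
  also have "\<dots> < card S"
    using assms(3,4) by (simp add: S_def card_cartesian_product card_PiE)
  finally have "\<not> inj_on g S"
    by (intro pigeonhole)
  then obtain f \<alpha> f' \<alpha>' where col: "(f, \<alpha>) \<in> S" "(f', \<alpha>') \<in> S" "(f, \<alpha>) \<noteq> (f', \<alpha>')" "g (f, \<alpha>) = g (f', \<alpha>')"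
    by (auto simp: inj_on_def)
  have eq: "(\<alpha> k + int f * c k) mod int q = (\<alpha>' k + int f' * c k) mod int q" if "k \<in> I" for k
    using fun_cong[OF col(4), of k] that by (simp add: g_def)
  have mem: "\<alpha> k \<in> A" "\<alpha>' k \<in> A" if "k \<in> I" for k
    using col(1,2) that by (auto simp: S_def)
  have "f \<noteq> f'"
  proof
    assume ff: "f = f'"
    have "\<alpha> = \<alpha>'"
    proof (rule PiE_ext)
      show "\<alpha> \<in> I \<rightarrow>\<^sub>E A" "\<alpha>' \<in> I \<rightarrow>\<^sub>E A"
        using col by (auto simp: S_def)
    next
      fix k assume k: "k \<in> I"
      have "\<alpha> k mod int q = \<alpha>' k mod int q"
        using eq[OF k] unfolding ff by (simp add: mod_eq_dvd_iff)
      moreover have "\<alpha> k \<in> {0..<int q}" "\<alpha>' k \<in> {0..<int q}"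
        using mem[OF k] assms(2) by auto
      ultimately show "\<alpha> k = \<alpha>' k" by simp
    qed
    with ff col(3) show False by simp
  qed
  have d: "int q dvd \<alpha> k - \<alpha>' k - (int f' - int f) * c k" if "k \<in> I" for k
    using eq[OF that] by (simp add: mod_eq_dvd_iff algebra_simps)
  show ?thesis
  proof (cases "f < f'")
    case True
    have "\<exists>a\<in>A. \<exists>a'\<in>A. int q dvd a - a' - int (f' - f) * c k" if "k \<in> I" for k
      using d[OF that] mem[OF that] True by (auto simp: of_nat_diff)
    then show ?thesis
      using True col(2) by (intro that[of "f' - f"]) (auto simp: S_def)
  next
    case False
    have "\<exists>a\<in>A. \<exists>a'\<in>A. int q dvd a - a' - int (f - f') * c k" if "k \<in> I" for k
    proof -
      have "int q dvd - (\<alpha> k - \<alpha>' k - (int f' - int f) * c k)"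
        using d[OF that] by (simp only: dvd_minus_iff)
      also have "- (\<alpha> k - \<alpha>' k - (int f' - int f) * c k) = \<alpha>' k - \<alpha> k - int (f - f') * c k"
        using False by (simp add: of_nat_diff algebra_simps)
      finally show ?thesis
        using mem[OF that] by blast
    qed
    then show ?thesis
      using False \<open>f \<noteq> f'\<close> col(1) by (intro that[of "f - f'"]) (auto simp: S_def)
  qed
qed

text \<open>The \<open>k\<close> that puts \<open>k * x\<close> into the differences of
  \<open>B\<close> depends on \<open>x\<close>, so one \<open>f\<close> has to serve all
  \<open>k\<close> at once; the factor \<open>k\<close> then cancels in the product.\<close>

lemma product_of_differences_pigeonhole:
  assumes "q > 0" "A \<subseteq> {0..<int q}" "B \<subseteq> {0..<int q}"
    and "q ^ m < n * card A ^ m" "q < (m + 1) * card B"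
  obtains f where "0 < f" "f < n"
    "\<And>x. \<exists>a\<in>A. \<exists>a'\<in>A. \<exists>b\<in>B. \<exists>b'\<in>B. int q dvd (a - a') * (b - b') - int (f * fact m) * x"
proof -
  obtain f where f: "0 < f" "f < n"
    "\<And>k. k \<in> {1..m} \<Longrightarrow> \<exists>a\<in>A. \<exists>a'\<in>A. int q dvd a - a' - int f * int (fact m div k)"
    using simultaneous_differences[OF assms(1,2), of "{1..m}" n "\<lambda>k. int (fact m div k)"] assms(4)
    by auto
  have "\<exists>a\<in>A. \<exists>a'\<in>A. \<exists>b\<in>B. \<exists>b'\<in>B. int q dvd (a - a') * (b - b') - int (f * fact m) * x" for x
  proof -
    \<comment> \<open>The one-dimensional case, with a one-point index set and \<open>m + 1\<close>
      translates.\<close>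
    obtain k where k: "0 < k" "k < m + 1" "\<exists>b\<in>B. \<exists>b'\<in>B. int q dvd b - b' - int k * x"
      using simultaneous_differences[OF assms(1,3), of "{()}" "m + 1" "\<lambda>_. x"] assms(5) by auto
    then obtain b b' where b: "b \<in> B" "b' \<in> B" "[b - b' = int k * x] (mod int q)"
      by (auto simp: cong_iff_dvd_diff)
    obtain a a' where a: "a \<in> A" "a' \<in> A" "[a - a' = int f * int (fact m div k)] (mod int q)"
      using f(3)[of k] k by (auto simp: cong_iff_dvd_diff)
    have "k dvd fact m"
      using k by (intro dvd_fact) auto
    have "int f * int (fact m div k) * (int k * x) = int (f * (fact m div k * k)) * x"
      by simp
    also have "\<dots> = int (f * fact m) * x"
      using \<open>k dvd fact m\<close> by (simp only: dvd_div_mult_self)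
    finally have "int f * int (fact m div k) * (int k * x) = int (f * fact m) * x" .
    then have "[(a - a') * (b - b') = int (f * fact m) * x] (mod int q)"
      using cong_mult[OF a(3) b(3)] by (simp only:)
    then show ?thesis
      using a b by (auto simp: cong_iff_dvd_diff)
  qed
  with f show ?thesis
    using that by blast
qed

section \<open>Choice of the divisor\<close>

text \<open>\<open>D\<close> need not divide \<open>q\<close>, but by Bezout its multiples modulo
  \<open>q\<close> are those of \<open>gcd D q\<close>.\<close>

lemma dilate_subset_product:
  assumes "q > 0" "A \<subseteq> carrier (Zmod q)" "B \<subseteq> carrier (Zmod q)"
    and sol: "\<And>x. \<exists>a\<in>A. \<exists>a'\<in>A. \<exists>b\<in>B. \<exists>b'\<in>B. int q dvd (a - a') * (b - b') - int D * x"
  shows "dilate (Zmod q) (gcd D q) (carrier (Zmod q))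
    \<subseteq> diff_set (Zmod q) A A <#>\<^bsub>Zmod q\<^esub> diff_set (Zmod q) B B"
proof
  fix y assume "y \<in> dilate (Zmod q) (gcd D q) (carrier (Zmod q))"
  then obtain x where y: "y = (int (gcd D q) * x) mod int q"
    by (auto simp: dilate_def Zmod_add_pow)
  obtain u v where uv: "u * int D + v * int q = gcd (int D) (int q)"
    using bezout_int by blast
  obtain a a' b b' where ab: "a \<in> A" "a' \<in> A" "b \<in> B" "b' \<in> B"
      "int q dvd (a - a') * (b - b') - int D * (u * x)"
    using sol by blast
  have "int (gcd D q) * x = (u * int D + v * int q) * x"
    by (simp only: uv gcd_int_int_eq)
  also have "\<dots> = int D * (u * x) + int q * (v * x)"
    by (simp add: ring_distribs)
  finally have "y = (int D * (u * x)) mod int q"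
    by (simp add: y)
  also have "\<dots> = ((a - a') * (b - b')) mod int q"
    using ab(5) by (simp only: mod_eq_dvd_iff dvd_diff_commute[of "int q" "int D * (u * x)"])
  also have "\<dots> = (a \<ominus>\<^bsub>Zmod q\<^esub> a') \<otimes>\<^bsub>Zmod q\<^esub> (b \<ominus>\<^bsub>Zmod q\<^esub> b')"
    using ab assms(2,3) by (simp add: Zmod_mult Zmod_minus[OF assms(1)] subset_iff mod_mult_eq)
  finally show "y \<in> diff_set (Zmod q) A A <#>\<^bsub>Zmod q\<^esub> diff_set (Zmod q) B B"
    using ab unfolding set_mult_def diff_set_def by blast
qed

text \<open>As \<open>ln (1 / \<beta>) \<le> 1 / \<beta>\<close>, even the exponent
  \<open>C * \<beta> powr (- 2)\<close> suffices.\<close>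

lemma powr_le_exp_powr:
  fixes \<beta> C s :: real
  assumes "0 < \<beta>" "\<beta> \<le> 1" "0 \<le> s" "s \<le> C / \<beta>"
  shows "\<beta> powr (- s) \<le> exp (C * \<beta> powr (- 4))"
proof -
  have "0 \<le> C / \<beta>"
    using assms(3,4) by linarith
  then have C: "0 \<le> C"
    using assms(1) by (simp add: zero_le_divide_iff)
  have "ln (1 / \<beta>) \<le> 1 / \<beta> - 1"
    using assms(1) by (intro ln_le_minus_one) simp
  then have ln: "- ln \<beta> \<le> 1 / \<beta>"
    using assms(1) by (simp add: ln_div)
  have "- s * ln \<beta> = s * (- ln \<beta>)"
    by simp
  also have "\<dots> \<le> (C / \<beta>) * (1 / \<beta>)"
    using assms ln C by (intro mult_mono) auto
  also have "\<dots> = C * \<beta> powr (- 2)"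
    using assms(1) by (simp add: powr_minus field_simps power2_eq_square)
  also have "\<dots> \<le> C * \<beta> powr (- 4)"
    using assms(1,2) C by (intro mult_left_mono powr_mono') auto
  finally show ?thesis
    using assms(1) by (simp add: powr_def)
qed

theorem theorem6:
  shows "\<exists>C C' C'' :: real. C > 0 \<and> C' > 0 \<and> C'' > 0 \<and>
    (\<forall>(q :: nat) (A :: int set) (B :: int set) (\<alpha> :: real) (\<beta> :: real).
      q > 0 \<and> A \<subseteq> carrier (Zmod q) \<and> B \<subseteq> carrier (Zmod q) \<and> A \<noteq> {} \<and> B \<noteq> {} \<and>
      real (card A) = \<alpha> * real q \<and> real (card B) = \<beta> * real q \<and> \<alpha> \<ge> \<beta> \<longrightarrow>
      (\<exists>d :: nat. d dvd q \<and>
        real d \<le> C' * exp (C * \<beta> powr (- 4)) \<and>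
        dilate (Zmod q) d (carrier (Zmod q))
          \<subseteq> diff_set (Zmod q) A A <#>\<^bsub>Zmod q\<^esub> diff_set (Zmod q) B B \<and>
        real d \<le> C' * \<beta> powr (- C'' * real (omega q))))"
\<comment> \<open>\<open>2448 = 2 * 51 * 3 * 8\<close>: the cap at
  \<open>2 ^ (51 * (3 * L))\<close>, \<open>L = 8 * k\<close>, and
  \<open>2 ^ k \<le> \<beta> powr (- 2)\<close>.\<close>
proof (rule exI[of _ 2448], rule exI[of _ 1], rule exI[of _ 2448], intro conjI allI impI)
  fix q :: nat and A B :: "int set" and \<alpha> \<beta> :: real
  assume H: "q > 0 \<and> A \<subseteq> carrier (Zmod q) \<and> B \<subseteq> carrier (Zmod q) \<and> A \<noteq> {} \<and> B \<noteq> {} \<and>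
      real (card A) = \<alpha> * real q \<and> real (card B) = \<beta> * real q \<and> \<alpha> \<ge> \<beta>"
  then have q: "q > 0" and carr: "A \<subseteq> carrier (Zmod q)" "B \<subseteq> carrier (Zmod q)"
    and ne: "A \<noteq> {}" "B \<noteq> {}" and cA: "real (card A) = \<alpha> * real q"
    and cB: "real (card B) = \<beta> * real q" and ab: "\<beta> \<le> \<alpha>"
    by blast+
  have sub: "A \<subseteq> {0..<int q}" "B \<subseteq> {0..<int q}"
    using carr by (simp_all add: Zmod_carrier)
  then have fin: "finite A" "finite B"
    using finite_subset by blast+
  have "0 < \<beta> * real q"
    using fin ne by (simp flip: cB add: card_gt_0_iff)
  then have \<beta>0: "0 < \<beta>"
    using q by (simp add: zero_less_mult_iff)
  have "card B \<le> q"
    using card_mono[OF _ sub(2)] by simp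
  then have "\<beta> * real q \<le> 1 * real q"
    by (simp flip: cB)
  then have \<beta>1: "\<beta> \<le> 1"
    by (rule mult_right_le_imp_le) (use q in simp)
  have cAB: "\<beta> * real q \<le> real (card A)"
    unfolding cA using ab by (intro mult_right_mono) auto
  define goal where "goal = (\<exists>d :: nat. d dvd q \<and> real d \<le> 1 * exp (2448 * \<beta> powr (- 4)) \<and>
        dilate (Zmod q) d (carrier (Zmod q))
          \<subseteq> diff_set (Zmod q) A A <#>\<^bsub>Zmod q\<^esub> diff_set (Zmod q) B B \<and>
        real d \<le> 1 * \<beta> powr (- 2448 * real (omega q)))"
  \<comment> \<open>A single bound by \<open>\<beta> powr (- s)\<close> yields both estimates, one
    from each upper bound on \<open>s\<close>.\<close>
  have goalI: goal
    if "\<And>x. \<exists>a\<in>A. \<exists>a'\<in>A. \<exists>b\<in>B. \<exists>b'\<in>B. int q dvd (a - a') * (b - b') - int D * x"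
      and "0 < D" "real D \<le> \<beta> powr (- s)" "0 \<le> s" "s \<le> 2448 / \<beta>" "s \<le> 2448 * real (omega q)" for D s
  proof -
    have "gcd D q \<le> D"
      using that(2) by simp
    then have "real (gcd D q) \<le> \<beta> powr (- s)"
      using that(3) by linarith
    moreover have "\<beta> powr (- s) \<le> exp (2448 * \<beta> powr (- 4))"
      by (rule powr_le_exp_powr[OF \<beta>0 \<beta>1 that(4,5)])
    moreover have "\<beta> powr (- s) \<le> \<beta> powr (- 2448 * real (omega q))"
      using that(6) \<beta>0 \<beta>1 by (intro powr_mono') auto
    ultimately show ?thesis
      unfolding goal_def using dilate_subset_product[OF q carr that(1)]
      by (intro exI[of _ "gcd D q"]) auto
  qed
  \<comment> \<open>The pigeonhole exponent is at most \<open>2 / \<beta>\<close>, the smooth one is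
    \<open>2448 * omega q\<close>; comparing \<open>1 / \<beta>\<close> with \<open>omega q\<close>
    selects the one meeting both bounds.\<close>
  have goal
  proof (cases "1 / \<beta> \<le> real (omega q) \<or> 1 / 2 < \<beta>")
    case True
    \<comment> \<open>\<open>1 / \<beta> < m + 1\<close> gives \<open>q < (m + 1) * card B\<close>.
      The \<open>+ 1\<close> in \<open>n\<close> makes it exceed \<open>(1 / \<beta>) ^ m\<close>,
      while \<open>f < n\<close> still yields \<open>f \<le> (1 / \<beta>) ^ m\<close>.\<close>
    define m where "m = nat \<lfloor>1 / \<beta>\<rfloor>"
    define n where "n = nat \<lfloor>(1 / \<beta>) ^ m\<rfloor> + 1"
    have inv: "1 \<le> 1 / \<beta>"
      using \<beta>0 \<beta>1 by simp
    have m: "real m \<le> 1 / \<beta>" "1 / \<beta> < real (m + 1)"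
      using inv unfolding m_def by linarith+
    have pw: "0 \<le> (1 / \<beta>) ^ m"
      using \<beta>0 by simp
    then have n: "(1 / \<beta>) ^ m < real n"
      unfolding n_def by linarith
    have "real (q ^ m) < real (n * card A ^ m)"
    proof -
      have "real (q ^ m) = (1 / \<beta>) ^ m * (\<beta> * real q) ^ m"
        using \<beta>0 by (simp flip: power_mult_distrib)
      also have "\<dots> < real n * (\<beta> * real q) ^ m"
        using n \<beta>0 q by (intro mult_strict_right_mono) auto
      also have "\<dots> \<le> real n * real (card A) ^ m"
        using cAB \<beta>0 by (intro mult_left_mono power_mono) auto
      finally show ?thesis
        by simp
    qed
    then have "q ^ m < n * card A ^ m"
      by (simp only: of_nat_less_iff)
    moreover have "real q < real ((m + 1) * card B)"
    proof -
      have "real q = 1 / \<beta> * (\<beta> * real q)"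
        using \<beta>0 by simp
      also have "\<dots> < real (m + 1) * (\<beta> * real q)"
        using m(2) \<beta>0 q by (intro mult_strict_right_mono) auto
      finally show ?thesis
        by (simp only: cB of_nat_mult)
    qed
    then have "q < (m + 1) * card B"
      by (simp only: of_nat_less_iff)
    ultimately obtain f where f: "0 < f" "f < n"
      "\<And>x. \<exists>a\<in>A. \<exists>a'\<in>A. \<exists>b\<in>B. \<exists>b'\<in>B. int q dvd (a - a') * (b - b') - int (f * fact m) * x"
      using product_of_differences_pigeonhole[OF q sub, of m n] by blast
    have fn: "real f \<le> (1 / \<beta>) ^ m"
      using f(2) pw unfolding n_def by linarith
    show ?thesis
    \<comment> \<open>For \<open>\<beta> > 1 / 2\<close>, \<open>omega q\<close> may be 0, so the
      exponent is 0: \<open>m = 1\<close> and \<open>f \<le> 1 / \<beta> < 2\<close> give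
      \<open>f * fact m = 1\<close>.\<close>
    proof (cases "1 / 2 < \<beta>")
      case True
      then have "1 / \<beta> < 2"
        using \<beta>0 by (simp add: field_simps)
      then have "m = 1"
        using m inv by linarith
      then have "f = 1"
        using fn f(1) \<open>1 / \<beta> < 2\<close> by simp
      show ?thesis
        using f(3) \<beta>0 by (intro goalI[of 1 0]) (auto simp: \<open>f = 1\<close> \<open>m = 1\<close>)
    next
      case False
      have "real (f * fact m) \<le> (1 / \<beta>) ^ m * (1 / \<beta>) ^ m"
      proof -
        have "real (fact m) \<le> real m ^ m"
          using fact_le_power[of m, where 'a = real] by simp
        also have "\<dots> \<le> (1 / \<beta>) ^ m"
          using m(1) by (intro power_mono) auto
        finally show ?thesis
          unfolding of_nat_mult using fn \<beta>0 by (intro mult_mono) auto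
      qed
      also have "\<dots> = \<beta> powr (- (2 * real m))"
        using \<beta>0 by (simp add: powr_minus powr_realpow[symmetric] powr_add[symmetric] field_simps power_one_over)
      finally have D: "real (f * fact m) \<le> \<beta> powr (- (2 * real m))" .
      have "real m \<le> real (omega q)"
        using True False m(1) by linarith
      then show ?thesis
        using f(1,3) D m(1) \<beta>0 inv by (intro goalI[of "f * fact m" "2 * real m"]) auto
    qed
  next
    case False
    then have \<omega>: "real (omega q) < 1 / \<beta>" and half: "\<beta> \<le> 1 / 2"
      by auto
    have two: "2 \<le> 1 / \<beta>"
      using half \<beta>0 by (simp add: field_simps)
    \<comment> \<open>Minimality gives \<open>2 ^ k \<le> 2 / \<beta>\<close>, which is at most
      \<open>\<beta> powr (- 2)\<close> because \<open>\<beta> \<le> 1 / 2\<close>.\<close>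
    define k where "k = (LEAST k. 1 / \<beta> \<le> 2 ^ k)"
    have k: "1 / \<beta> \<le> 2 ^ k"
    proof -
      obtain x where "1 / \<beta> < 2 ^ x"
        using real_arch_pow[of 2 "1 / \<beta>"] by auto
      then show ?thesis
        unfolding k_def by (intro LeastI[of "\<lambda>k. 1 / \<beta> \<le> 2 ^ k" x]) simp
    qed
    have "k \<noteq> 0"
      using k two by (auto intro: Nat.gr0I)
    then obtain l where l: "k = Suc l"
      using not0_implies_Suc by blast
    have "\<not> 1 / \<beta> \<le> 2 ^ l"
      using not_less_Least[of l "\<lambda>k. 1 / \<beta> \<le> 2 ^ k"] l by (simp add: k_def)
    then have "2 ^ k \<le> 2 * (1 / \<beta>)"
      by (simp add: l)
    also have "\<dots> \<le> (1 / \<beta>) * (1 / \<beta>)"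
      using two \<beta>0 by (intro mult_right_mono) auto
    also have "\<dots> = \<beta> powr (- 2)"
      using \<beta>0 by (simp add: powr_minus field_simps power2_eq_square)
    finally have k2: "2 ^ k \<le> \<beta> powr (- 2)" .
    \<comment> \<open>\<open>(11 / 10) ^ 8 > 2\<close>, so \<open>(11 / 10) ^ L\<close> covers the
      energy ratio \<open>1 / \<beta>\<close>.\<close>
    define L where "L = 8 * k"
    have "(2::real) ^ k \<le> ((11 / 10) ^ 8) ^ k"
      by (intro power_mono) (simp_all add: power_divide)
    then have "1 / \<beta> \<le> (11 / 10) ^ L"
      using k by (simp add: L_def power_mult)
    then have "1 / \<beta> * (\<beta> * real q) \<le> (11 / 10) ^ L * (\<beta> * real q)"
      using \<beta>0 by (intro mult_right_mono) auto
    then have LB: "real q \<le> (11 / 10) ^ L * (\<beta> * real q)"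
      using \<beta>0 by simp
    also have "\<dots> \<le> (11 / 10) ^ L * real (card A)"
      using cAB by (intro mult_left_mono) auto
    finally have LA: "real q \<le> (11 / 10) ^ L * real (card A)" .
    define D where "D = prime_power_cap q (2 ^ (51 * (3 * L)))"
    have sol: "\<exists>a\<in>A. \<exists>a'\<in>A. \<exists>b\<in>B. \<exists>b'\<in>B. int q dvd (a - a') * (b - b') - int D * x" for x
      unfolding D_def
      by (rule product_of_differences_smooth[OF q sub ne LA]) (use LB cB in simp)
    have "D \<le> (2 ^ (51 * (3 * L))) ^ omega q"
      unfolding D_def by (rule prime_power_cap_le[OF q]) simp
    then have "real D \<le> real ((2 ^ (51 * (3 * L))) ^ omega q)"
      by (simp only: of_nat_le_iff)
    also have "\<dots> = (2 ^ k) ^ (1224 * omega q)"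
      by (simp add: L_def mult_ac flip: power_mult)
    also have "\<dots> \<le> (\<beta> powr (- 2)) ^ (1224 * omega q)"
      using k2 by (intro power_mono) auto
    also have "\<dots> = \<beta> powr (- (2448 * real (omega q)))"
      using \<beta>0 by (simp add: powr_realpow[symmetric] powr_powr)
    finally have DD: "real D \<le> \<beta> powr (- (2448 * real (omega q)))" .
    show ?thesis
      using sol DD \<omega> by (intro goalI[of D "2448 * real (omega q)"]) (auto simp: D_def prime_power_cap_pos)
  qed
  then show "\<exists>d :: nat. d dvd q \<and> real d \<le> 1 * exp (2448 * \<beta> powr (- 4)) \<and>
        dilate (Zmod q) d (carrier (Zmod q))
          \<subseteq> diff_set (Zmod q) A A <#>\<^bsub>Zmod q\<^esub> diff_set (Zmod q) B B \<and>
        real d \<le> 1 * \<beta> powr (- 2448 * real (omega q))"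
    unfolding goal_def .
qed simp_all

end
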